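(* Let $(\Omega,\phi)$ be a multi-domain and $(u_n)$ a sequence of solutions of the minimal surface equation on $\Omega$. Let $P$ be an interior point of $\Omega$, $N$ a unit tangent vector to $\Omega$ at $P$ (identified via $d\phi$ with a horizontal unit vector of $\mathbb{R}^3$), and let $D$ be the (maximal) geodesic of $\Omega$ through $P$ orthogonal to $N$. If $N_n(P)\to N$, then $N_n(Q)\to N$ at every point $Q$ of $D$, where at $Q$ the vector $N$ denotes the parallel transport of $N$ along $D$.
   Context: A multi-domain is a pair $(\Omega,\phi)$ where $\Omega$ is a simply connected $2$-dimensional complete flat manifold with piecewise smooth boundary, $\phi:\Omega\to\mathbb{R}^2$ is a local isometry, and each connected component of the smooth part of $\partial\Omega$ is a convex arc. A function $u$ solves the minimal surface equation if in local Euclidean coordinates $(x,y)$ given by $\phi$, $(1+q^2)r-2pqs+(1+p^2)t=0$ with $p=u_x,q=u_y,r=u_{xx},s=u_{xy},t=u_{yy}$. For $u_n$, with $p_n,q_n$ its first derivatives in these coordinates and $W_n=\sqrt{1+p_n^2+q_n^2}$, the normal to its graph over $Q$ is $N_n(Q)=\left(\frac{p_n}{W_n}(Q),\frac{q_n}{W_n}(Q),-\frac{1}{W_n}(Q)\right)$, the horizontal components being read through $d\phi$. *)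

theory Defs
  imports "HOL-Analysis.Analysis"
begin

type_synonym pt = "real \<times> real"

definition local_chart :: "'a::topological_space set \<Rightarrow> ('a \<Rightarrow> pt) \<Rightarrow> 'a \<Rightarrow> 'a set \<Rightarrow> bool" where
  "local_chart \<Omega> \<phi> x U \<longleftrightarrow> openin (top_of_set \<Omega>) U \<and> x \<in> U \<and> (\<exists>\<psi>. homeomorphism U (\<phi> ` U) \<phi> \<psi>)"

definition interior_pt :: "'a::topological_space set \<Rightarrow> ('a \<Rightarrow> pt) \<Rightarrow> 'a \<Rightarrow> bool" where
  "interior_pt \<Omega> \<phi> x \<longleftrightarrow> x \<in> \<Omega> \<and> (\<exists>U. local_chart \<Omega> \<phi> x U \<and> open (\<phi> ` U))"

definition mboundary :: "'a::topological_space set \<Rightarrow> ('a \<Rightarrow> pt) \<Rightarrow> 'a set" where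
  "mboundary \<Omega> \<phi> = {x \<in> \<Omega>. \<not> interior_pt \<Omega> \<phi> x}"

fun vd :: "nat \<Rightarrow> real set \<Rightarrow> (real \<Rightarrow> pt) \<Rightarrow> real \<Rightarrow> pt" where
  "vd 0 S c = c"
| "vd (Suc k) S c = (\<lambda>t. vector_derivative (vd k S c) (at t within S))"

definition smooth_on :: "real set \<Rightarrow> (real \<Rightarrow> pt) \<Rightarrow> bool" where
  "smooth_on S c \<longleftrightarrow> (\<forall>k. \<forall>t\<in>S. vd k S c differentiable (at t within S))"

definition rot90 :: "pt \<Rightarrow> pt" where
  "rot90 w = (- snd w, fst w)"

definition det2 :: "pt \<Rightarrow> pt \<Rightarrow> real" where
  "det2 a b = fst a * snd b - snd a * fst b"

definition boundary_chart :: "'a::topological_space set \<Rightarrow> ('a \<Rightarrow> pt) \<Rightarrow> 'a \<Rightarrow> 'a set \<Rightarrow> real \<Rightarrow> (real \<Rightarrow> pt) \<Rightarrow> bool" where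
  "boundary_chart \<Omega> \<phi> x U r c \<longleftrightarrow> local_chart \<Omega> \<phi> x U \<and> r > 0 \<and> continuous_on {-1..1} c \<and>
     inj_on c {-1..1} \<and> c 0 = \<phi> x \<and> c (-1) \<in> sphere (\<phi> x) r \<and> c 1 \<in> sphere (\<phi> x) r \<and>
     c ` {-1<..<1} \<subseteq> ball (\<phi> x) r \<and>
     (\<exists>C. C \<in> components (ball (\<phi> x) r - c ` {-1..1}) \<and> \<phi> ` U = C \<union> c ` {-1<..<1})"

text \<open>Piecewise smooth boundary chart (possibly a corner at parameter 0).\<close>
definition pw_smooth_bchart :: "'a::topological_space set \<Rightarrow> ('a \<Rightarrow> pt) \<Rightarrow> 'a \<Rightarrow> 'a set \<Rightarrow> real \<Rightarrow> (real \<Rightarrow> pt) \<Rightarrow> bool" where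
  "pw_smooth_bchart \<Omega> \<phi> x U r c \<longleftrightarrow> boundary_chart \<Omega> \<phi> x U r c \<and>
     smooth_on {-1..0} c \<and> smooth_on {0..1} c \<and>
     (\<forall>t\<in>{-1..0}. vd 1 {-1..0} c t \<noteq> 0) \<and> (\<forall>t\<in>{0..1}. vd 1 {0..1} c t \<noteq> 0)"

text \<open>Smooth boundary chart, oriented so that the domain lies to the left of c.\<close>
definition smooth_bchart :: "'a::topological_space set \<Rightarrow> ('a \<Rightarrow> pt) \<Rightarrow> 'a \<Rightarrow> 'a set \<Rightarrow> real \<Rightarrow> (real \<Rightarrow> pt) \<Rightarrow> bool" where
  "smooth_bchart \<Omega> \<phi> x U r c \<longleftrightarrow> boundary_chart \<Omega> \<phi> x U r c \<and>
     smooth_on {-1..1} c \<and> (\<forall>t\<in>{-1..1}. vd 1 {-1..1} c t \<noteq> 0) \<and>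
     (\<exists>e>0. \<forall>s\<in>{0<..<e}. c 0 + s *\<^sub>R rot90 (vd 1 {-1..1} c 0) \<in> \<phi> ` U)"

definition smooth_part :: "'a::topological_space set \<Rightarrow> ('a \<Rightarrow> pt) \<Rightarrow> 'a set" where
  "smooth_part \<Omega> \<phi> = {x \<in> mboundary \<Omega> \<phi>. \<exists>U r c. smooth_bchart \<Omega> \<phi> x U r c}"

text \<open>A connected set K of smooth boundary points is a convex arc: the (signed, w.r.t. the
  side of the domain) curvature does not change sign along K.\<close>
definition convex_arc :: "'a::topological_space set \<Rightarrow> ('a \<Rightarrow> pt) \<Rightarrow> 'a set \<Rightarrow> bool" where
  "convex_arc \<Omega> \<phi> K \<longleftrightarrow>
     (\<forall>y\<in>K. \<forall>U r c. smooth_bchart \<Omega> \<phi> y U r c \<longrightarrow> det2 (vd 1 {-1..1} c 0) (vd 2 {-1..1} c 0) \<ge> 0) \<or>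
     (\<forall>y\<in>K. \<forall>U r c. smooth_bchart \<Omega> \<phi> y U r c \<longrightarrow> det2 (vd 1 {-1..1} c 0) (vd 2 {-1..1} c 0) \<le> 0)"

definition plen :: "('a \<Rightarrow> pt) \<Rightarrow> (real \<Rightarrow> 'a) \<Rightarrow> ereal" where
  "plen \<phi> g = Sup {ereal (\<Sum>i<k. dist (\<phi> (g (t (Suc i)))) (\<phi> (g (t i)))) | k t.
                      t 0 = 0 \<and> t k = 1 \<and> (\<forall>i<k. t i \<le> t (Suc i))}"

definition idist :: "'a::topological_space set \<Rightarrow> ('a \<Rightarrow> pt) \<Rightarrow> 'a \<Rightarrow> 'a \<Rightarrow> ereal" where
  "idist \<Omega> \<phi> x y = Inf {plen \<phi> g | g. path g \<and> path_image g \<subseteq> \<Omega> \<and> pathstart g = x \<and> pathfinish g = y}"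

definition icomplete :: "'a::topological_space set \<Rightarrow> ('a \<Rightarrow> pt) \<Rightarrow> bool" where
  "icomplete \<Omega> \<phi> \<longleftrightarrow> (\<forall>X. (\<forall>n. X n \<in> \<Omega>) \<and>
      (\<forall>e>0. \<exists>M. \<forall>m\<ge>M. \<forall>n\<ge>M. idist \<Omega> \<phi> (X m) (X n) < ereal e) \<longrightarrow>
      (\<exists>L\<in>\<Omega>. X \<longlonglongrightarrow> L))"

definition multi_domain :: "'a::t2_space set \<Rightarrow> ('a \<Rightarrow> pt) \<Rightarrow> bool" where
  "multi_domain \<Omega> \<phi> \<longleftrightarrow> \<Omega> \<noteq> {} \<and> simply_connected \<Omega> \<and>
     (\<forall>x\<in>\<Omega>. interior_pt \<Omega> \<phi> x \<or> (\<exists>U r c. pw_smooth_bchart \<Omega> \<phi> x U r c)) \<and>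
     icomplete \<Omega> \<phi> \<and>
     (\<forall>x\<in>smooth_part \<Omega> \<phi>. convex_arc \<Omega> \<phi> (connected_component_set (smooth_part \<Omega> \<phi>) x))"

definition locinv :: "'a::topological_space set \<Rightarrow> ('a \<Rightarrow> pt) \<Rightarrow> 'a \<Rightarrow> pt \<Rightarrow> 'a" where
  "locinv \<Omega> \<phi> x = (SOME \<psi>. \<exists>V. open V \<and> \<phi> x \<in> V \<and> \<psi> (\<phi> x) = x \<and> continuous_on V \<psi> \<and>
                       \<psi> ` V \<subseteq> \<Omega> \<and> (\<forall>z\<in>V. \<phi> (\<psi> z) = z))"

definition px :: "(pt \<Rightarrow> real) \<Rightarrow> pt \<Rightarrow> real" where
  "px f z = deriv (\<lambda>s. f (s, snd z)) (fst z)"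

definition py :: "(pt \<Rightarrow> real) \<Rightarrow> pt \<Rightarrow> real" where
  "py f z = deriv (\<lambda>s. f (fst z, s)) (snd z)"

definition mse_solution :: "'a::topological_space set \<Rightarrow> ('a \<Rightarrow> pt) \<Rightarrow> ('a \<Rightarrow> real) \<Rightarrow> bool" where
  "mse_solution \<Omega> \<phi> u \<longleftrightarrow> (\<forall>x. interior_pt \<Omega> \<phi> x \<longrightarrow>
     (\<exists>V. open V \<and> \<phi> x \<in> V \<and>
        (\<forall>z\<in>V. let f = u \<circ> locinv \<Omega> \<phi> x; p = px f z; q = py f z;
                   r = px (px f) z; s = py (px f) z; t = py (py f) z in
           f differentiable (at z) \<and> px f differentiable (at z) \<and> py f differentiable (at z) \<and>
           (1 + q\<^sup>2) * r - 2 * p * q * s + (1 + p\<^sup>2) * t = 0)))"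

text \<open>Normal N(Q) to the graph of u over Q (horizontal part read through d phi).\<close>
definition gnormal :: "'a::topological_space set \<Rightarrow> ('a \<Rightarrow> pt) \<Rightarrow> ('a \<Rightarrow> real) \<Rightarrow> 'a \<Rightarrow> real \<times> real \<times> real" where
  "gnormal \<Omega> \<phi> u Q = (let f = u \<circ> locinv \<Omega> \<phi> Q; p = px f (\<phi> Q); q = py f (\<phi> Q);
                         W = sqrt (1 + p\<^sup>2 + q\<^sup>2) in (p / W, q / W, - 1 / W))"

definition geodesic_through :: "'a::topological_space set \<Rightarrow> ('a \<Rightarrow> pt) \<Rightarrow> 'a \<Rightarrow> pt \<Rightarrow> 'a set" where
  "geodesic_through \<Omega> \<phi> P v = {\<gamma> t | \<gamma> t. \<exists>I. is_interval I \<and> open I \<and> 0 \<in> I \<and> t \<in> I \<and>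
      continuous_on I \<gamma> \<and> \<gamma> 0 = P \<and>
      (\<forall>s\<in>I. interior_pt \<Omega> \<phi> (\<gamma> s) \<and> \<phi> (\<gamma> s) = \<phi> P + s *\<^sub>R v)}"

end

theory Submission
  imports Defs "HOL-Complex_Analysis.Complex_Analysis"
begin

text \<open>
  Identify the plane with the complex numbers and let \<^emph>\<open>g = (p - iq) / (1 + W)\<close>, so that
  \<^emph>\<open>|g| < 1\<close>. Over a disc of radius \<^emph>\<open>R\<close> about \<^emph>\<open>c\<close>, Lewy's map \<^emph>\<open>\<Xi>(z) = z + (F, G)\<close> with
  \<^emph>\<open>dF = ((1 + p^2) dx + pq dy) / W\<close> and \<^emph>\<open>dG = (pq dx + (1 + q^2) dy) / W\<close> does not decrease distances,
  so its image contains the disc of radius \<^emph>\<open>R\<close> about \<^emph>\<open>\<Xi>(c)\<close>. On that disc \<^emph>\<open>g\<close> is a holomorphic function of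
  \<^emph>\<open>\<zeta> = \<Xi>(z)\<close>, \<^emph>\<open>dz = (d\<zeta> - cnj (g^2 d\<zeta>)) / 2\<close>, and the conjugate function \<^emph>\<open>\<psi>\<close> with
  \<^emph>\<open>d\<psi> = (p dy - q dx) / W = Im (g d\<zeta>)\<close> is 1-Lipschitz in \<^emph>\<open>z\<close>.

  Write \<^emph>\<open>h = N g\<close>; the normal is close to \<^emph>\<open>N\<close> iff \<^emph>\<open>h\<close> is close to 1. Since \<^emph>\<open>Re (1 - h) > 0\<close>,
  smallness of \<^emph>\<open>\<epsilon> = |1 - h|\<close> at \<^emph>\<open>c\<close> spreads over half of the \<^emph>\<open>\<zeta>\<close>-disc, and \<^emph>\<open>\<psi>\<close> grows along the line
  \<^emph>\<open>c + \<tau> iN\<close> at the maximal rate 1 up to \<^emph>\<open>O(\<epsilon>)\<close>. If \<^emph>\<open>|1 - h| = \<eta>\<close> at a point \<^emph>\<open>Q\<close> of this line, then,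
  because \<^emph>\<open>d(\<psi> - Im (cnj N z)) = - Im ((1 - h)^2 cnj N d\<zeta>) / 2\<close>, some point at distance at most \<^emph>\<open>r\<close>
  from \<^emph>\<open>Q\<close> gains a further \<^emph>\<open>r \<eta>^2 / 4\<close>, which contradicts the Lipschitz bound for suitable \<^emph>\<open>r\<close>
  unless \<^emph>\<open>\<eta>^4 = O(\<epsilon>)\<close>. Connectedness of the geodesic turns this local estimate into the theorem.
\<close>

section \<open>Potentials of closed differentiable one-forms\<close>

text \<open>
  The coefficients are only differentiable, not continuously differentiable, so exactness needs a
  Goursat argument. The real form \<^emph>\<open>A dx + B dy\<close> is written as \<^emph>\<open>Re (\<phi> dz)\<close> with \<^emph>\<open>\<phi> = A - iB\<close>.
\<close>

lemma Re_contour_integral_affine: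
  fixes D :: "complex \<Rightarrow> complex"
  assumes D: "bounded_linear D" and sym: "Re (D \<i>) = - Im (D 1)"
  shows "Re (contour_integral (linepath a b) (\<lambda>z. k + D (z - x))) =
      (Re (k * b) + Re ((b - x) * D (b - x)) / 2) - (Re (k * a) + Re ((a - x) * D (a - x)) / 2)"
proof -
  interpret D: bounded_linear D by fact
  have Dv: "D v = Re v *\<^sub>R D 1 + Im v *\<^sub>R D \<i>" for v
    by (metis D.add D.scaleR complex_eq mult.commute mult.right_neutral of_real_def scaleR_conv_of_real)
  have symD: "Re (v * D w) = Re (w * D v)" for v w
    unfolding Dv[of v] Dv[of w] using sym by (simp add: algebra_simps)
  define Q where "Q z = Re (k * z) + Re ((z - x) * D (z - x)) / 2" for z
  have cont: "continuous_on A (\<lambda>z. k + D (z - x))" for A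
    by (intro continuous_intros D.continuous_on)
  have "((\<lambda>z. k + D (z - x)) has_contour_integral contour_integral (linepath a b) (\<lambda>z. k + D (z - x))) (linepath a b)"
    by (intro has_contour_integral_integral contour_integrable_continuous_linepath cont)
  then have 1: "((\<lambda>t. Re ((k + D (linepath a b t - x)) * (b - a))) has_integral
        Re (contour_integral (linepath a b) (\<lambda>z. k + D (z - x)))) {0..1}"
    unfolding has_contour_integral_linepath by (rule has_integral_Re)
  have "((\<lambda>t. Re ((k + D (linepath a b t - x)) * (b - a))) has_integral
        Q (linepath a b 1) - Q (linepath a b 0)) {0..1}"
  proof (rule fundamental_theorem_of_calculus)
    fix t :: real assume "t \<in> {0..1}"
    have "(linepath a b has_vector_derivative b - a) (at t within {0..1})"
      by (rule has_vector_derivative_linepath_within)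
    then have l: "(linepath a b has_derivative (\<lambda>s. s *\<^sub>R (b - a))) (at t within {0..1})"
      by (simp add: has_vector_derivative_def)
    have "((\<lambda>s. Q (linepath a b s)) has_derivative
       (\<lambda>s. Re (k * (s *\<^sub>R (b - a))) + Re ((linepath a b t - x) * D (s *\<^sub>R (b - a)) + s *\<^sub>R (b - a) * D (linepath a b t - x)) / 2)) (at t within {0..1})"
      unfolding Q_def
      by (rule derivative_eq_intros D.has_derivative l refl | simp)+
    then show "((\<lambda>s. Q (linepath a b s)) has_vector_derivative Re ((k + D (linepath a b t - x)) * (b - a))) (at t within {0..1})"
      unfolding has_vector_derivative_def
    proof (rule has_derivative_eq_rhs, intro ext)
      fix s
      have "Re ((linepath a b t - x) * D (s *\<^sub>R (b - a))) = Re (s *\<^sub>R (b - a) * D (linepath a b t - x))"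
        by (rule symD)
      then have "Re ((linepath a b t - x) * D (s *\<^sub>R (b - a)) + s *\<^sub>R (b - a) * D (linepath a b t - x)) / 2
          = Re (s *\<^sub>R (b - a) * D (linepath a b t - x))"
        unfolding plus_complex.sel by simp
      then show "Re (k * (s *\<^sub>R (b - a))) + Re ((linepath a b t - x) * D (s *\<^sub>R (b - a)) + s *\<^sub>R (b - a) * D (linepath a b t - x)) / 2
          = s *\<^sub>R Re ((k + D (linepath a b t - x)) * (b - a))"
        by (simp add: algebra_simps)
    qed
  qed simp
  from has_integral_unique[OF 1 this] show ?thesis
    by (simp add: Q_def linepath_def)
qed

text \<open>Local step of Goursat's argument: the affine part of \<open>\<phi>\<close> at
  \<open>x\<close> has a potential and contributes nothing around the triangle. The remainder is
  pointwise at most \<open>e\<close> times the perimeter, and the path is as long as the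
  perimeter.\<close>

lemma closed_form_small_triangle:
  assumes der: "(\<phi> has_derivative D) (at x)" and sym: "Re (D \<i>) = - Im (D 1)"
    and cont: "continuous_on S \<phi>" and e: "0 < e"
  shows "\<exists>d>0. \<forall>a b c. convex hull {a,b,c} \<subseteq> S \<and> x \<in> convex hull {a,b,c} \<and>
     dist a b \<le> d \<and> dist b c \<le> d \<and> dist c a \<le> d \<longrightarrow>
     \<bar>Re (contour_integral (linepath a b) \<phi> + contour_integral (linepath b c) \<phi> + contour_integral (linepath c a) \<phi>)\<bar>
       \<le> e * (dist a b + dist b c + dist c a)\<^sup>2"
proof -
  interpret D: bounded_linear D using der by (rule has_derivative_bounded_linear)
  obtain d where d: "d > 0" "\<And>y. norm (y - x) < d \<Longrightarrow> norm (\<phi> y - \<phi> x - D (y - x)) \<le> e * norm (y - x)"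
    using der e unfolding has_derivative_at_alt by blast
  define A where "A z = \<phi> x + D (z - x)" for z
  show ?thesis
  proof (intro exI[of _ "d/2"] conjI allI impI)
    fix a b c assume H: "convex hull {a,b,c} \<subseteq> S \<and> x \<in> convex hull {a,b,c} \<and>
     dist a b \<le> d/2 \<and> dist b c \<le> d/2 \<and> dist c a \<le> d/2"
    define p where "p = dist a b + dist b c + dist c a"
    have near: "norm (y - x) \<le> p" "norm (y - x) < d" if "y \<in> convex hull {a,b,c}" for y
    proof -
      \<comment> \<open>Two points of a triangle are no further apart than its longest side, so
        sides of length at most \<open>d/2\<close> keep the triangle strictly within the radius
        \<open>d\<close> of the linearization.\<close>
      have "norm (y - x) \<le> dist a b \<or> norm (y - x) \<le> dist b c \<or> norm (y - x) \<le> dist c a"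
        using triangle_points_closer[of y a b c x] that H by (simp add: dist_norm)
      moreover have "dist a b \<le> p" "dist b c \<le> p" "dist c a \<le> p" by (simp_all add: p_def)
      ultimately show "norm (y - x) \<le> p" "norm (y - x) < d" using H d by linarith+
    qed
    have seg: "\<bar>Re (contour_integral (linepath u v) \<phi>) - Re (contour_integral (linepath u v) A)\<bar> \<le> e * p * dist u v"
      if uv: "u \<in> convex hull {a,b,c}" "v \<in> convex hull {a,b,c}" for u v
    proof -
      have sub: "closed_segment u v \<subseteq> convex hull {a,b,c}"
        using uv by (simp add: closed_segment_subset)
      have i1: "\<phi> contour_integrable_on linepath u v"
        by (meson H cont contour_integrable_continuous_linepath continuous_on_subset sub)
      have i2: "A contour_integrable_on linepath u v" unfolding A_def
        by (intro contour_integrable_continuous_linepath continuous_intros D.continuous_on)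
      have "((\<lambda>z. \<phi> z - A z) has_contour_integral (contour_integral (linepath u v) \<phi> - contour_integral (linepath u v) A)) (linepath u v)"
        by (intro has_contour_integral_diff has_contour_integral_integral i1 i2)
      then have "norm (contour_integral (linepath u v) \<phi> - contour_integral (linepath u v) A) \<le> e * p * norm (v - u)"
      proof (rule has_contour_integral_bound_linepath)
        show "0 \<le> e * p" using e by (simp add: p_def)
        fix z assume "z \<in> closed_segment u v"
        with sub have z: "z \<in> convex hull {a,b,c}" by blast
        have "norm (\<phi> z - A z) \<le> e * norm (z - x)"
          using d(2)[OF near(2)[OF z]] by (simp add: A_def algebra_simps)
        also have "\<dots> \<le> e * p" using near(1)[OF z] e by simp
        finally show "norm (\<phi> z - A z) \<le> e * p" .
      qed
      then show ?thesis
        by (metis abs_Re_le_cmod minus_complex.sel(1) order_trans dist_norm dist_commute)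
    qed
    have "a \<in> convex hull {a,b,c}" "b \<in> convex hull {a,b,c}" "c \<in> convex hull {a,b,c}"
      by (auto intro: hull_inc)
    note seg[OF this(1,2)] seg[OF this(2,3)] seg[OF this(3,1)]
    moreover have "Re (contour_integral (linepath a b) A) + Re (contour_integral (linepath b c) A) + Re (contour_integral (linepath c a) A) = 0"
      unfolding A_def by (simp add: Re_contour_integral_affine[OF D.bounded_linear sym])
    ultimately have "\<bar>Re (contour_integral (linepath a b) \<phi> + contour_integral (linepath b c) \<phi> + contour_integral (linepath c a) \<phi>)\<bar>
       \<le> e * p * dist a b + e * p * dist b c + e * p * dist c a" by simp
    also have "\<dots> = e * p\<^sup>2" by (simp add: p_def power2_eq_square algebra_simps)
    finally show "\<bar>Re (contour_integral (linepath a b) \<phi> + contour_integral (linepath b c) \<phi> + contour_integral (linepath c a) \<phi>)\<bar>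
       \<le> e * (dist a b + dist b c + dist c a)\<^sup>2" by (simp add: p_def)
  qed (use d in auto)
qed

text \<open>The inner edges of the four midpoint triangles cancel, so one of these triangles carries
  at least a quarter of the integral. Halving \<open>K\<close> divides the lower bound by exactly
  four.\<close>

lemma closed_form_quadrisection:
  fixes \<phi> :: "complex \<Rightarrow> complex"
  defines "T \<equiv> \<lambda>a b c. Re (contour_integral (linepath a b) \<phi> + contour_integral (linepath b c) \<phi> + contour_integral (linepath c a) \<phi>)"
  assumes cont: "continuous_on (convex hull {a,b,c}) \<phi>"
    and dist: "dist a b \<le> K" "dist b c \<le> K" "dist c a \<le> K"
    and e: "e * K\<^sup>2 \<le> \<bar>T a b c\<bar>"
  shows "\<exists>a' b' c'. a' \<in> convex hull {a,b,c} \<and> b' \<in> convex hull {a,b,c} \<and> c' \<in> convex hull {a,b,c} \<and>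
    dist a' b' \<le> K/2 \<and> dist b' c' \<le> K/2 \<and> dist c' a' \<le> K/2 \<and> e * (K/2)\<^sup>2 \<le> \<bar>T a' b' c'\<bar>"
proof -
  define x where "x = midpoint b c"
  define y where "y = midpoint c a"
  define z where "z = midpoint a b"
  let ?I = "\<lambda>u v. contour_integral (linepath u v) \<phi>"
  have ins: "a \<in> convex hull {a,b,c}" "b \<in> convex hull {a,b,c}" "c \<in> convex hull {a,b,c}"
    by (auto intro: hull_inc)
  then have insm: "x \<in> convex hull {a,b,c}" "y \<in> convex hull {a,b,c}" "z \<in> convex hull {a,b,c}"
    unfolding x_def y_def z_def by (metis closed_segment_subset convex_convex_hull midpoint_in_closed_segment subsetD)+
  have cs: "continuous_on (closed_segment u v) \<phi>" if "u \<in> convex hull {a,b,c}" "v \<in> convex hull {a,b,c}" for u v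
    using cont that by (meson closed_segment_subset continuous_on_subset convex_convex_hull)
  have split: "?I a b = ?I a z + ?I z b" "?I b c = ?I b x + ?I x c" "?I c a = ?I c y + ?I y a"
    unfolding x_def y_def z_def by (intro contour_integral_midpoint cs ins)+
  have rev: "?I z y = - ?I y z" "?I x z = - ?I z x" "?I y x = - ?I x y"
    by (intro contour_integral_reverse_linepath cs insm)+
  have "T a b c = T a z y + T b x z + T c y x + T x y z"
    by (simp add: T_def split rev)
  then have "e * (K/2)\<^sup>2 \<le> \<bar>T a z y\<bar> \<or> e * (K/2)\<^sup>2 \<le> \<bar>T b x z\<bar> \<or> e * (K/2)\<^sup>2 \<le> \<bar>T c y x\<bar> \<or> e * (K/2)\<^sup>2 \<le> \<bar>T x y z\<bar>"
    using e by (simp add: power_divide) linarith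
  moreover have half: "dist (midpoint u v) (midpoint u w) \<le> K/2" if "dist v w \<le> K" for u v w :: complex
  proof -
    have "midpoint u v - midpoint u w = (1/2) *\<^sub>R (v - w)"
      by (simp add: midpoint_def algebra_simps)
    then show ?thesis using that by (simp add: dist_norm)
  qed
  have "dist z y \<le> K/2" "dist x z \<le> K/2" "dist y x \<le> K/2"
    using half[of b c a] half[of c a b] half[of a b c] dist
    by (simp_all add: x_def y_def z_def midpoint_sym dist_commute)
  moreover have "dist a z \<le> K/2" "dist y a \<le> K/2" "dist b x \<le> K/2" "dist z b \<le> K/2" "dist c y \<le> K/2" "dist x c \<le> K/2"
    using dist by (simp_all add: x_def y_def z_def dist_midpoint dist_commute)
  ultimately show ?thesis using ins insm
    by (metis dist_commute)
qed

lemma closed_form_triangle: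
  fixes \<phi> :: "complex \<Rightarrow> complex"
  assumes der: "\<And>x. x \<in> convex hull {a,b,c} \<Longrightarrow> (\<phi> has_derivative D x) (at x)"
    and sym: "\<And>x. x \<in> convex hull {a,b,c} \<Longrightarrow> Re (D x \<i>) = - Im (D x 1)"
  shows "Re (contour_integral (linepath a b) \<phi> + contour_integral (linepath b c) \<phi> + contour_integral (linepath c a) \<phi>) = 0"
proof (rule ccontr)
  define T where "T a b c = Re (contour_integral (linepath a b) \<phi> + contour_integral (linepath b c) \<phi> + contour_integral (linepath c a) \<phi>)" for a b c
  assume "\<not> ?thesis"
  then have nz: "T a b c \<noteq> 0" by (simp add: T_def)
  have cont: "continuous_on (convex hull {a,b,c}) \<phi>"
    by (meson continuous_at_imp_continuous_on der has_derivative_continuous)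
  \<comment> \<open>The summand 1 keeps \<open>K\<close> positive even for a degenerate
    triangle.\<close>
  define K where "K = 1 + dist a b + dist b c + dist c a"
  have K: "K > 0" unfolding K_def by (simp add: add_pos_nonneg)
  define e where "e = \<bar>T a b c\<bar> / K\<^sup>2"
  have e: "e > 0" using nz K by (simp add: e_def)
  define At where "At x y z n \<longleftrightarrow> convex hull {x,y,z} \<subseteq> convex hull {a,b,c} \<and>
    dist x y \<le> K/2^n \<and> dist y z \<le> K/2^n \<and> dist z x \<le> K/2^n \<and> e * (K/2^n)\<^sup>2 \<le> \<bar>T x y z\<bar>" for x y z and n :: nat
  have At0: "At a b c 0"
    using K by (simp add: At_def e_def) (simp add: K_def)
  have AtSuc: "\<exists>x' y' z'. At x' y' z' (Suc n) \<and> convex hull {x',y',z'} \<subseteq> convex hull {x,y,z}" if "At x y z n" for x y z n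
  proof -
    have "continuous_on (convex hull {x,y,z}) \<phi>"
      using cont continuous_on_subset that by (auto simp: At_def)
    from closed_form_quadrisection[OF this, of "K/2^n" e] that
    obtain x' y' z' where *: "x' \<in> convex hull {x,y,z}" "y' \<in> convex hull {x,y,z}" "z' \<in> convex hull {x,y,z}"
       "dist x' y' \<le> K/2^n/2" "dist y' z' \<le> K/2^n/2" "dist z' x' \<le> K/2^n/2" "e * (K/2^n/2)\<^sup>2 \<le> \<bar>T x' y' z'\<bar>"
      unfolding At_def T_def by blast
    have "convex hull {x',y',z'} \<subseteq> convex hull {x,y,z}"
      using * by (intro hull_minimal) auto
    with * that show ?thesis
      unfolding At_def by (intro exI[of _ x'] exI[of _ y'] exI[of _ z']) (auto simp: mult.commute)
  qed
  obtain f g h where At: "\<And>n. At (f n) (g n) (h n) n"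
     and nest: "\<And>n. convex hull {f (Suc n), g (Suc n), h (Suc n)} \<subseteq> convex hull {f n, g n, h n}"
    by (rule Chain3[of At a b c "\<lambda>x' y' z' x y z. convex hull {x',y',z'} \<subseteq> convex hull {x,y,z}", OF At0 AtSuc]) auto
  obtain x where x: "\<And>n. x \<in> convex hull {f n, g n, h n}"
  proof (rule bounded_closed_nest)
    show "closed (convex hull {f n, g n, h n})" for n
      by (simp add: compact_imp_closed finite_imp_compact_convex_hull)
    show "convex hull {f n, g n, h n} \<subseteq> convex hull {f m, g m, h m}" if "m \<le> n" for m n
      using that nest by (induction rule: dec_induct) auto
  qed (fastforce intro: finite_imp_bounded_convex_hull)+
  have xin: "x \<in> convex hull {a,b,c}" using x[of 0] At[of 0] by (auto simp: At_def)
  \<comment> \<open>The factor 1/10 beats the square of the perimeter bound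
    \<open>3 * (K/2^n)\<close>: a small nested triangle would have an integral of at most 9/10 of
    its own lower bound.\<close>
  obtain d where d: "d > 0" and small: "\<And>a' b' c'. convex hull {a',b',c'} \<subseteq> convex hull {a,b,c} \<Longrightarrow> x \<in> convex hull {a',b',c'} \<Longrightarrow>
     dist a' b' \<le> d \<Longrightarrow> dist b' c' \<le> d \<Longrightarrow> dist c' a' \<le> d \<Longrightarrow> \<bar>T a' b' c'\<bar> \<le> e/10 * (dist a' b' + dist b' c' + dist c' a')\<^sup>2"
    using closed_form_small_triangle[OF der[OF xin] sym[OF xin] cont, of "e/10"] e unfolding T_def by auto
  obtain n where n: "K / d < 2 ^ n" using real_arch_pow[of 2] by auto
  have "K / 2^n \<le> d" using n d by (simp add: field_simps)
  with At[of n] have dl: "dist (f n) (g n) \<le> d" "dist (g n) (h n) \<le> d" "dist (h n) (f n) \<le> d"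
    unfolding At_def by linarith+
  have "e * (K/2^n)\<^sup>2 \<le> e/10 * (dist (f n) (g n) + dist (g n) (h n) + dist (h n) (f n))\<^sup>2"
    using small[OF _ x dl] At[of n] unfolding At_def by linarith
  also have "\<dots> \<le> e/10 * (3 * (K/2^n))\<^sup>2"
    using At[of n] e unfolding At_def by (intro mult_left_mono power_mono) auto
  also have "\<dots> = 9/10 * (e * (K/2^n)\<^sup>2)" by (simp add: power2_eq_square)
  finally have "e * (K/2^n)\<^sup>2 \<le> 0" by linarith
  then have "(K/2^n)\<^sup>2 \<le> 0" using e by (simp add: mult_le_0_iff)
  then show False using K by simp
qed

text \<open>The potential is the integral along the straight segment from a base point; the
  vanishing triangle integrals turn a difference of two values into the integral over the segment
  between them.\<close>

theorem closed_form_potential: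
  fixes \<phi> :: "complex \<Rightarrow> complex"
  assumes S: "convex S" "open S"
    and der: "\<And>x. x \<in> S \<Longrightarrow> (\<phi> has_derivative D x) (at x)"
    and sym: "\<And>x. x \<in> S \<Longrightarrow> Re (D x \<i>) = - Im (D x 1)"
  obtains F where "\<And>x. x \<in> S \<Longrightarrow> (F has_derivative (\<lambda>v. Re (\<phi> x * v))) (at x)"
proof (cases "S = {}")
  case False
  then obtain a where a: "a \<in> S" by blast
  let ?I = "\<lambda>u v. contour_integral (linepath u v) \<phi>"
  have cont: "continuous_on S \<phi>"
    by (meson continuous_at_imp_continuous_on der has_derivative_continuous)
  have cs: "continuous_on (closed_segment u v) \<phi>" if "u \<in> S" "v \<in> S" for u v
    using cont that S by (meson closed_segment_subset continuous_on_subset)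
  have diff: "Re (?I a y) - Re (?I a x) = Re (?I x y)" if "x \<in> S" "y \<in> S" for x y
  proof -
    have "convex hull {a,x,y} \<subseteq> S" using a that S by (intro hull_minimal) auto
    then have "Re (?I a x + ?I x y + ?I y a) = 0"
      by (intro closed_form_triangle[of _ _ _ _ D]) (use der sym in blast)+
    moreover have "?I y a = - ?I a y"
      by (intro contour_integral_reverse_linepath cs a that)
    ultimately show ?thesis by simp
  qed
  show ?thesis
  proof (rule that)
    fix x assume x: "x \<in> S"
    show "((\<lambda>z. Re (?I a z)) has_derivative (\<lambda>v. Re (\<phi> x * v))) (at x)"
      unfolding has_derivative_at_alt
    proof (intro conjI allI impI)
      show "bounded_linear (\<lambda>v. Re (\<phi> x * v))"
        by (intro bounded_linear_compose[OF bounded_linear_Re] bounded_linear_mult_right)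
      fix e :: real assume e: "0 < e"
      obtain d1 where d1: "d1 > 0" "ball x d1 \<subseteq> S" using S x openE by blast
      obtain d2 where d2: "d2 > 0" "\<And>y. y \<in> S \<Longrightarrow> dist y x < d2 \<Longrightarrow> dist (\<phi> y) (\<phi> x) < e"
        using cont x e unfolding continuous_on_iff by metis
      show "\<exists>d>0. \<forall>y. norm (y - x) < d \<longrightarrow> norm (Re (?I a y) - Re (?I a x) - Re (\<phi> x * (y - x))) \<le> e * norm (y - x)"
      proof (intro exI[of _ "min d1 d2"] conjI allI impI)
        fix y assume "norm (y - x) < min d1 d2"
        then have y: "y \<in> S" "dist y x < d2" using d1 by (auto simp: dist_norm norm_minus_commute subset_iff)
        \<comment> \<open>The first-order remainder is the integral of the oscillation of
          \<open>\<phi>\<close> over the segment, which continuity makes small.\<close>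
        have "((\<lambda>z. \<phi> z - \<phi> x) has_contour_integral (?I x y - \<phi> x * (y - x))) (linepath x y)"
          by (intro has_contour_integral_diff has_contour_integral_integral contour_integrable_continuous_linepath cs x y has_contour_integral_const_linepath)
        then have "norm (?I x y - \<phi> x * (y - x)) \<le> e * norm (y - x)"
        proof (rule has_contour_integral_bound_linepath)
          fix z assume z: "z \<in> closed_segment x y"
          then have "z \<in> S" using S x y by (meson closed_segment_subset subsetD)
          moreover have "dist z x < d2" using segment_bound1[OF z] y by (simp add: dist_norm)
          ultimately show "norm (\<phi> z - \<phi> x) \<le> e" using d2(2)[of z] by (simp add: dist_norm)
        qed (use e in simp)
        then show "norm (Re (?I a y) - Re (?I a x) - Re (\<phi> x * (y - x))) \<le> e * norm (y - x)"
          unfolding diff[OF x y(1)] using abs_Re_le_cmod[of "?I x y - \<phi> x * (y - x)"] by simp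
      qed (use d1 d2 in simp)
    qed
  qed
qed (use that in blast)

lemma closed_one_form_exact:
  fixes A B :: "complex \<Rightarrow> real"
  assumes S: "convex S" "open S"
    and A: "\<And>x. x \<in> S \<Longrightarrow> (A has_derivative A' x) (at x)"
    and B: "\<And>x. x \<in> S \<Longrightarrow> (B has_derivative B' x) (at x)"
    and closed: "\<And>x. x \<in> S \<Longrightarrow> A' x \<i> = B' x 1"
  obtains F where "\<And>x. x \<in> S \<Longrightarrow> (F has_derivative (\<lambda>v. A x * Re v + B x * Im v)) (at x)"
proof -
  define \<phi> where "\<phi> z = of_real (A z) - \<i> * of_real (B z)" for z
  obtain F where F: "\<And>x. x \<in> S \<Longrightarrow> (F has_derivative (\<lambda>v. Re (\<phi> x * v))) (at x)"
  proof (rule closed_form_potential[OF S])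
    fix x assume x: "x \<in> S"
    show "(\<phi> has_derivative (\<lambda>v. of_real (A' x v) - \<i> * of_real (B' x v))) (at x)"
      unfolding \<phi>_def by (intro derivative_intros A B x)
    show "Re (of_real (A' x \<i>) - \<i> * of_real (B' x \<i>)) = - Im (of_real (A' x 1) - \<i> * of_real (B' x 1))"
      using closed[OF x] by simp
  qed blast
  show ?thesis
    by (rule that[of F]) (use F in \<open>simp add: \<phi>_def\<close>)
qed

section \<open>Holomorphic functions with positive real part and expanding maps\<close>

text \<open>A Harnack-type inequality. After rescaling to the unit disc, the Cayley transform
  \<open>m\<close> of \<open>k\<close> relative to \<open>k 0\<close> is a self-map of the disc
  fixing 0, and Schwarz's lemma applied to \<open>m\<close> is solved for \<open>k\<close>.\<close>

lemma positive_real_part_deviation: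
  assumes hol: "k holomorphic_on ball 0 R" and pos: "\<And>z. z \<in> ball 0 R \<Longrightarrow> 0 < Re (k z)"
    and z: "norm z < R"
  shows "norm (k z - k 0) \<le> 2 * norm z / (R - norm z) * Re (k 0)"
proof -
  have R: "R > 0" using z by (meson norm_ge_zero order_le_less_trans)
  define m where "m w = (k (of_real R * w) - k 0) / (k (of_real R * w) + cnj (k 0))" for w
  have inb: "of_real R * w \<in> ball 0 R" if "norm w < 1" for w :: complex
    using that R by (simp add: norm_mult)
  have k0: "Re (k 0) > 0" using pos[of 0] R by simp
  have den: "k u + cnj (k 0) \<noteq> 0" if "u \<in> ball 0 R" for u
    using pos[OF that] k0 by (auto simp: complex_eq_iff)
  have m1: "norm (m w) < 1" if w: "norm w < 1" for w
  proof -
    let ?u = "of_real R * w"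
    \<comment> \<open>The two squares differ by \<open>4 * Re (k ?u) * Re (k 0)\<close>.\<close>
    have "(norm (k ?u - k 0))\<^sup>2 < (norm (k ?u + cnj (k 0)))\<^sup>2"
      using pos[OF inb[OF w]] k0 unfolding cmod_power2
      by (simp add: power2_eq_square algebra_simps)
    then have "norm (k ?u - k 0) < norm (k ?u + cnj (k 0))"
      by (simp add: power2_less_imp_less)
    then show ?thesis
      using den[OF inb[OF w]] by (simp add: m_def norm_divide divide_less_eq)
  qed
  have "(\<lambda>w. k (of_real R * w)) holomorphic_on ball 0 1"
    by (intro holomorphic_on_compose_gen[of "\<lambda>w. of_real R * w" "ball 0 1" k "ball 0 R", unfolded o_def]
        holomorphic_intros hol) (use inb in auto)
  then have mhol: "m holomorphic_on ball 0 1"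
    unfolding m_def using den inb by (intro holomorphic_intros) auto
  let ?w = "z / of_real R"
  have w: "norm ?w < 1" using z R by (simp add: norm_divide)
  have Sch: "norm (m ?w) \<le> norm ?w"
    using Schwarz_Lemma(1)[OF mhol _ m1 w] by (simp add: m_def)
  have Rw: "of_real R * ?w = z" using R by simp
  have mz: "m ?w * (k z + cnj (k 0)) = k z - k 0"
    using den[of z] z R by (simp add: m_def)
  \<comment> \<open>Solving \<open>mz\<close> for \<open>k z - k 0\<close>: the factor that remains
    on the right is the real number \<open>2 * Re (k 0)\<close>.\<close>
  have "(k z - k 0) * (1 - m ?w) = m ?w * (k z + cnj (k 0)) * (1 - m ?w)" using mz by simp
  also have "\<dots> = m ?w * ((k z + cnj (k 0)) - (k z - k 0))"
    using mz by algebra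
  also have "\<dots> = m ?w * of_real (2 * Re (k 0))"
    by (simp add: complex_eq_iff)
  finally have "norm (k z - k 0) * norm (1 - m ?w) = norm (m ?w) * (2 * Re (k 0))"
    using k0 by (metis abs_of_pos mult_pos_pos norm_mult norm_of_real zero_less_numeral)
  moreover have "1 - norm ?w \<le> norm (1 - m ?w)"
    using Sch norm_triangle_ineq2[of 1 "m ?w"] by simp
  ultimately have "norm (k z - k 0) * (1 - norm ?w) \<le> norm ?w * (2 * Re (k 0))"
    using Sch k0 by (smt (verit, ccfv_SIG) mult_left_mono mult_right_mono norm_ge_zero)
  then have "norm (k z - k 0) * (R - norm z) \<le> norm z * (2 * Re (k 0))"
    using R mult_left_mono[of "norm (k z - k 0) * (1 - norm ?w)" "norm ?w * (2 * Re (k 0))" R]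
    by (simp add: norm_divide algebra_simps)
  then show ?thesis using z by (simp add: field_simps)
qed

text \<open>Within the connected target ball the image is open by invariance of domain, and closed
  because preimages of a convergent sequence form a Cauchy sequence.\<close>

lemma ball_subset_expanding_image:
  fixes f :: "'a \<Rightarrow> 'a::euclidean_space"
  assumes cont: "continuous_on (ball c R) f"
    and exp: "\<And>x y. x \<in> ball c R \<Longrightarrow> y \<in> ball c R \<Longrightarrow> dist x y \<le> dist (f x) (f y)"
  shows "ball (f c) R \<subseteq> f ` ball c R"
proof (cases "R > 0")
  case R: True
  let ?T = "ball (f c) R" and ?S = "f ` ball c R \<inter> ball (f c) R"
  have "inj_on f (ball c R)"
    by (rule inj_onI) (metis dist_eq_0_iff dist_le_zero_iff exp)
  then have "open (f ` ball c R)"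
    by (intro invariance_of_domain cont) auto
  then have op: "openin (top_of_set ?T) ?S"
    by (metis inf_commute openin_open)
  have cl: "closedin (top_of_set ?T) ?S"
    unfolding closedin_limpt
  proof (intro conjI allI impI)
    fix y assume y: "y islimpt ?S \<and> y \<in> ?T"
    then obtain s where s: "\<And>n. s n \<in> ?S" "s \<longlonglongrightarrow> y"
      unfolding islimpt_sequential by blast
    then have "\<forall>n. \<exists>x\<in>ball c R. s n = f x" by blast
    then obtain x where x: "\<And>n. x n \<in> ball c R" "\<And>n. s n = f (x n)" by metis
    have "Cauchy s" using s by (simp add: LIMSEQ_imp_Cauchy)
    then have "Cauchy x"
      unfolding Cauchy_def using exp x by (metis order_le_less_trans)
    then obtain l where l: "x \<longlonglongrightarrow> l" using Cauchy_convergent_iff convergent_def by blast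
    \<comment> \<open>The expansion inequality survives in the limit, so \<open>l\<close> stays in
      the open ball because \<open>y\<close> does.\<close>
    have "dist c l \<le> dist (f c) y"
    proof (rule LIMSEQ_le)
      show "(\<lambda>n. dist c (x n)) \<longlonglongrightarrow> dist c l" by (intro tendsto_intros l)
      show "(\<lambda>n. dist (f c) (s n)) \<longlonglongrightarrow> dist (f c) y" by (intro tendsto_intros s)
      show "\<exists>N. \<forall>n\<ge>N. dist c (x n) \<le> dist (f c) (s n)" using exp x R by auto
    qed
    then have lin: "l \<in> ball c R" using y by auto
    then have "isCont f l" using cont by (simp add: continuous_on_eq_continuous_at)
    then have "(\<lambda>n. f (x n)) \<longlonglongrightarrow> f l" using l by (rule isCont_tendsto_compose)
    then have "y = f l" using s x by (metis LIMSEQ_unique tendsto_cong_limit ext)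
    then show "y \<in> ?S" using lin y by blast
  qed auto
  have "f c \<in> ?S" using R by auto
  then have "?S = ?T"
    using op cl connected_ball[of "f c" R] unfolding connected_clopen by blast
  then show ?thesis by blast
next
  case False
  then have "ball (f c) R = {}" by simp
  then show ?thesis by blast
qed

lemma cnj_mult_self_unit: "norm (N::complex) = 1 \<Longrightarrow> cnj N * N = 1"
  by (metis complex_norm_square mult.commute of_real_1 one_power2)

section \<open>The Gauss map in conformal coordinates\<close>

text \<open>The data are the gradient \<open>(p, q)\<close> of a solution and its Hessian entries.
  Sharing \<open>s\<close> between \<open>deriv_p\<close> and \<open>deriv_q\<close> expresses
  symmetry of the Hessian; no continuity of \<open>r\<close>, \<open>s\<close>, \<open>t\<close> is
  assumed.\<close>

locale minimal_gradient =
  fixes S :: "complex set" and p q r s t :: "complex \<Rightarrow> real"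
  assumes convex_domain: "convex S" and open_domain: "open S"
    and deriv_p: "\<And>z. z \<in> S \<Longrightarrow> (p has_derivative (\<lambda>v. r z * Re v + s z * Im v)) (at z)"
    and deriv_q: "\<And>z. z \<in> S \<Longrightarrow> (q has_derivative (\<lambda>v. s z * Re v + t z * Im v)) (at z)"
    and mse: "\<And>z. z \<in> S \<Longrightarrow> (1 + (q z)\<^sup>2) * r z - 2 * p z * q z * s z + (1 + (p z)\<^sup>2) * t z = 0"
begin

definition W :: "complex \<Rightarrow> real" where "W z = sqrt (1 + (p z)\<^sup>2 + (q z)\<^sup>2)"

definition g :: "complex \<Rightarrow> complex" where "g z = Complex (p z) (- q z) / of_real (1 + W z)"

lemma W_ge_1: "1 \<le> W z"
  unfolding W_def by simp

lemma W_pos: "0 < W z"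
  using W_ge_1[of z] by linarith

lemma W_square: "(W z)\<^sup>2 = 1 + (p z)\<^sup>2 + (q z)\<^sup>2"
  unfolding W_def by (simp add: add_nonneg_nonneg)

lemma deriv_W:
  assumes "z \<in> S"
  shows "(W has_derivative (\<lambda>v. (p z * (r z * Re v + s z * Im v) + q z * (s z * Re v + t z * Im v)) / W z)) (at z)"
proof -
  have pos: "1 + (p z)\<^sup>2 + (q z)\<^sup>2 > 0" by (simp add: add_pos_nonneg)
  show ?thesis
    unfolding W_def[abs_def]
    by (rule derivative_eq_intros deriv_p[OF assms] deriv_q[OF assms] refl pos | simp)+
       (use pos in \<open>simp add: fun_eq_iff divide_simps algebra_simps\<close>)
qed

lemma deriv_over_W:
  assumes "z \<in> S" "(f has_derivative f') (at z)"
  shows "((\<lambda>z. f z / W z) has_derivative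
    (\<lambda>v. f' v / W z - f z * (p z * (r z * Re v + s z * Im v) + q z * (s z * Re v + t z * Im v)) / W z ^ 3)) (at z)"
  using W_pos[of z]
  by (auto intro!: derivative_eq_intros assms deriv_W simp: fun_eq_iff field_simps power3_eq_cube)

lemma norm_g_less_1: "norm (g z) < 1"
proof -
  have "(norm (Complex (p z) (- q z)))\<^sup>2 = (W z)\<^sup>2 - 1"
    unfolding cmod_power2 W_square by simp
  also have "\<dots> < (1 + W z)\<^sup>2" using W_pos[of z] by (simp add: power2_eq_square algebra_simps)
  finally have "norm (Complex (p z) (- q z)) < 1 + W z"
    using W_pos[of z] by (meson add_nonneg_nonneg less_eq_real_def power2_less_imp_less zero_le_one)
  then show ?thesis using W_pos[of z] by (simp add: g_def norm_divide del: of_real_add)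
qed

section \<open>Conjugate function and Lewy's potentials\<close>

text \<open>Closedness of the form is the minimal surface equation in divergence form,
  \<open>(p/W)_x + (q/W)_y = 0\<close>.\<close>

lemma stream_function:
  obtains \<psi> where "\<And>z. z \<in> S \<Longrightarrow> (\<psi> has_derivative (\<lambda>v. (p z * Im v - q z * Re v) / W z)) (at z)"
proof -
  obtain \<psi> where \<psi>: "\<And>z. z \<in> S \<Longrightarrow> (\<psi> has_derivative (\<lambda>v. (- q z / W z) * Re v + (p z / W z) * Im v)) (at z)"
  proof (rule closed_one_form_exact[OF convex_domain open_domain])
    fix z assume z: "z \<in> S"
    show "((\<lambda>z. - q z / W z) has_derivative (\<lambda>v. - (s z * Re v + t z * Im v) / W z -
       (- q z) * (p z * (r z * Re v + s z * Im v) + q z * (s z * Re v + t z * Im v)) / W z ^ 3)) (at z)"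
      by (intro deriv_over_W has_derivative_minus deriv_q z)
    show "((\<lambda>z. p z / W z) has_derivative (\<lambda>v. (r z * Re v + s z * Im v) / W z -
       p z * (p z * (r z * Re v + s z * Im v) + q z * (s z * Re v + t z * Im v)) / W z ^ 3)) (at z)"
      by (intro deriv_over_W deriv_p z)
    show "- (s z * Re \<i> + t z * Im \<i>) / W z -
       (- q z) * (p z * (r z * Re \<i> + s z * Im \<i>) + q z * (s z * Re \<i> + t z * Im \<i>)) / W z ^ 3
      = (r z * Re 1 + s z * Im 1) / W z -
       p z * (p z * (r z * Re 1 + s z * Im 1) + q z * (s z * Re 1 + t z * Im 1)) / W z ^ 3"
      using W_pos[of z] W_square[of z] mse[OF z]
      by (simp add: divide_simps power3_eq_cube) algebra
  qed blast
  show ?thesis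
    by (rule that[of \<psi>]) (use \<psi> in \<open>simp add: diff_divide_distrib algebra_simps\<close>)
qed

text \<open>Closedness of the two forms says that the coordinates \<open>x\<close> and
  \<open>y\<close> are harmonic on the graph: \<open>G\<close> is a harmonic conjugate of
  \<open>x\<close>, and \<open>-F\<close> of \<open>y\<close>.\<close>

lemma lewy_potentials:
  obtains F G where
    "\<And>z. z \<in> S \<Longrightarrow> (F has_derivative (\<lambda>v. ((1 + (p z)\<^sup>2) / W z) * Re v + (p z * q z / W z) * Im v)) (at z)"
    "\<And>z. z \<in> S \<Longrightarrow> (G has_derivative (\<lambda>v. (p z * q z / W z) * Re v + ((1 + (q z)\<^sup>2) / W z) * Im v)) (at z)"
proof -
  let ?dp = "\<lambda>z v. r z * Re v + s z * Im v" and ?dq = "\<lambda>z v. s z * Re v + t z * Im v"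
  let ?D = "\<lambda>f f' z v. f' / W z - f * (p z * ?dp z v + q z * ?dq z v) / W z ^ 3"
  have 1: "((\<lambda>z. (1 + (p z)\<^sup>2) / W z) has_derivative (\<lambda>v. ?D (1 + (p z)\<^sup>2) (2 * p z * ?dp z v) z v)) (at z)" if "z \<in> S" for z
    by (rule deriv_over_W[OF that]) (auto intro!: derivative_eq_intros deriv_p that)
  have 2: "((\<lambda>z. p z * q z / W z) has_derivative (\<lambda>v. ?D (p z * q z) (p z * ?dq z v + ?dp z v * q z) z v)) (at z)" if "z \<in> S" for z
    by (rule deriv_over_W[OF that]) (auto intro!: derivative_eq_intros deriv_p deriv_q that)
  have 3: "((\<lambda>z. (1 + (q z)\<^sup>2) / W z) has_derivative (\<lambda>v. ?D (1 + (q z)\<^sup>2) (2 * q z * ?dq z v) z v)) (at z)" if "z \<in> S" for z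
    by (rule deriv_over_W[OF that]) (auto intro!: derivative_eq_intros deriv_q that)
  obtain F where F: "\<And>z. z \<in> S \<Longrightarrow> (F has_derivative (\<lambda>v. ((1 + (p z)\<^sup>2) / W z) * Re v + (p z * q z / W z) * Im v)) (at z)"
  proof (rule closed_one_form_exact[OF convex_domain open_domain 1 2])
    fix z assume z: "z \<in> S"
    show "?D (1 + (p z)\<^sup>2) (2 * p z * ?dp z \<i>) z \<i> = ?D (p z * q z) (p z * ?dq z 1 + ?dp z 1 * q z) z 1"
      using W_pos[of z] W_square[of z] mse[OF z]
      by (simp add: divide_simps power3_eq_cube) algebra
  qed blast+
  obtain G where G: "\<And>z. z \<in> S \<Longrightarrow> (G has_derivative (\<lambda>v. (p z * q z / W z) * Re v + ((1 + (q z)\<^sup>2) / W z) * Im v)) (at z)"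
  proof (rule closed_one_form_exact[OF convex_domain open_domain 2 3])
    fix z assume z: "z \<in> S"
    show "?D (p z * q z) (p z * ?dq z \<i> + ?dp z \<i> * q z) z \<i> = ?D (1 + (q z)\<^sup>2) (2 * q z * ?dq z 1) z 1"
      using W_pos[of z] W_square[of z] mse[OF z]
      by (simp add: divide_simps power3_eq_cube) algebra
  qed blast+
  show ?thesis using that F G by blast
qed

lemma g_components: "Re (g z) = p z / (1 + W z)" "Im (g z) = - q z / (1 + W z)"
  by (simp_all add: g_def Re_divide_of_real Im_divide_of_real del: of_real_add)

text \<open>The differential, at \<^emph>\<open>\<Xi>(z)\<close>, of the inverse of Lewy's map.\<close>
definition Z' :: "complex \<Rightarrow> complex \<Rightarrow> complex" where
  "Z' z v = (v - cnj ((g z)\<^sup>2 * v)) / 2"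

lemma Z'_components:
  "Re (Z' z v) = ((1 + W z + (q z)\<^sup>2) * Re v - p z * q z * Im v) / (1 + W z)\<^sup>2"
  "Im (Z' z v) = ((1 + W z + (p z)\<^sup>2) * Im v - p z * q z * Re v) / (1 + W z)\<^sup>2"
proof -
  have ne: "1 + W z \<noteq> 0" using W_pos[of z] by linarith
  have g2: "(g z)\<^sup>2 = Complex (((p z)\<^sup>2 - (q z)\<^sup>2) / (1 + W z)\<^sup>2) (- 2 * p z * q z / (1 + W z)\<^sup>2)"
    by (simp add: complex_eq_iff power2_eq_square g_components) (simp add: diff_divide_distrib)
  have W2: "(1 + W z)\<^sup>2 = 2 + 2 * W z + (p z)\<^sup>2 + (q z)\<^sup>2"
    using W_square[of z] by (simp add: power2_sum)
  show "Re (Z' z v) = ((1 + W z + (q z)\<^sup>2) * Re v - p z * q z * Im v) / (1 + W z)\<^sup>2"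
    unfolding Z'_def g2 using ne W2 by (simp add: divide_simps) algebra
  show "Im (Z' z v) = ((1 + W z + (p z)\<^sup>2) * Im v - p z * q z * Re v) / (1 + W z)\<^sup>2"
    unfolding Z'_def g2 using ne W2 by (simp add: divide_simps) algebra
qed

lemma norm_Z'_le: "norm (Z' z v) \<le> norm v"
proof -
  have "norm ((g z)\<^sup>2) \<le> 1" using norm_g_less_1[of z] by (simp add: norm_power power_le_one)
  then have "norm ((g z)\<^sup>2 * v) \<le> norm v" by (simp add: norm_mult mult_left_le_one_le)
  then show ?thesis
    using norm_triangle_ineq4[of v "cnj ((g z)\<^sup>2 * v)"]
    by (simp add: Z'_def norm_divide del: complex_cnj_mult)
qed

lemma bounded_linear_Z': "bounded_linear (Z' z)"
proof (rule bounded_linear_intro[of _ 1])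
  show "norm (Z' z v) \<le> norm v * 1" for v using norm_Z'_le by simp
qed (simp_all add: Z'_def algebra_simps diff_divide_distrib add_divide_distrib scaleR_conv_of_real)

lemma deriv_g:
  assumes z: "z \<in> S"
  defines "dp \<equiv> \<lambda>v. r z * Re v + s z * Im v" and "dq \<equiv> \<lambda>v. s z * Re v + t z * Im v"
  defines "dW \<equiv> \<lambda>v. (p z * dp v + q z * dq v) / W z"
  shows "(g has_derivative (\<lambda>v. Complex (dp v / (1 + W z) - p z * dW v / (1 + W z)\<^sup>2)
            (- (dq v / (1 + W z) - q z * dW v / (1 + W z)\<^sup>2)))) (at z)"
proof -
  have ne: "1 + W z \<noteq> 0" using W_pos[of z] by linarith
  have g: "g = (\<lambda>z. of_real (p z / (1 + W z)) - \<i> * of_real (q z / (1 + W z)))"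
    by (simp add: fun_eq_iff complex_eq_iff g_components del: of_real_divide)
  have 1: "((\<lambda>z. p z / (1 + W z)) has_derivative (\<lambda>v. dp v / (1 + W z) - p z * dW v / (1 + W z)\<^sup>2)) (at z)"
    using ne by (auto intro!: derivative_eq_intros deriv_p[OF z] deriv_W[OF z] simp: dp_def dq_def dW_def fun_eq_iff divide_simps power2_eq_square)
  have 2: "((\<lambda>z. q z / (1 + W z)) has_derivative (\<lambda>v. dq v / (1 + W z) - q z * dW v / (1 + W z)\<^sup>2)) (at z)"
    using ne by (auto intro!: derivative_eq_intros deriv_q[OF z] deriv_W[OF z] simp: dp_def dq_def dW_def fun_eq_iff divide_simps power2_eq_square)
  have "(g has_derivative (\<lambda>v. of_real (dp v / (1 + W z) - p z * dW v / (1 + W z)\<^sup>2) -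
      \<i> * of_real (dq v / (1 + W z) - q z * dW v / (1 + W z)\<^sup>2))) (at z)"
    unfolding g by (intro derivative_intros 1 2)
  then show ?thesis
    by (rule has_derivative_eq_rhs) (auto simp: complex_eq_iff)
qed

section \<open>Conformality of the Gauss map and Lewy's parametrization\<close>

text \<open>These are the Cauchy-Riemann equations for \<open>g\<close> as a function of Lewy's
  coordinate. The real part (\<open>e1\<close>) needs only the symmetry of the Hessian; the
  imaginary part (\<open>e2\<close>) is a multiple of the minimal surface equation.\<close>

lemma cauchy_riemann_g:
  assumes z: "z \<in> S" and D: "(g has_derivative D) (at z)"
  shows "D (Z' z \<i>) = \<i> * D (Z' z 1)"
proof -
  define M where "M = 1 + W z"
  have ne: "M \<noteq> 0" "W z \<noteq> 0" using W_pos[of z] unfolding M_def by linarith+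
  \<comment> \<open>Up to the factor \<open>M\<^sup>2\<close>, the symmetric matrix with entries
    \<open>a\<close>, \<open>b\<close>, \<open>c\<close> is \<open>Z' z\<close>, and
    \<open>P1\<close>, \<open>Q1\<close>, \<open>P2\<close>, \<open>Q2\<close> are the derivatives
    of \<open>p\<close> and \<open>q\<close> along its two columns.\<close>
  define a b c where "a = M + (q z)\<^sup>2" and "b = - (p z * q z)" and "c = M + (p z)\<^sup>2"
  define P1 Q1 P2 Q2 where "P1 = r z * a + s z * b" and "Q1 = s z * a + t z * b"
    and "P2 = r z * b + s z * c" and "Q2 = s z * b + t z * c"
  have WM: "W z * M = M + (p z)\<^sup>2 + (q z)\<^sup>2"
    using W_square[of z] by (simp add: M_def power2_eq_square algebra_simps)
  have "W z * M * P2 - p z * (p z * P2 + q z * Q2) = a * P2 + b * Q2"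
    unfolding WM by (simp add: a_def b_def power2_eq_square algebra_simps)
  also have "\<dots> = c * Q1 + b * P1"
    by (simp add: P1_def Q1_def P2_def Q2_def algebra_simps)
  also have "\<dots> = W z * M * Q1 - q z * (p z * P1 + q z * Q1)"
    unfolding WM by (simp add: c_def b_def power2_eq_square algebra_simps)
  finally have e1: "W z * M * P2 - p z * (p z * P2 + q z * Q2) = W z * M * Q1 - q z * (p z * P1 + q z * Q1)" .
  have MW: "(p z)\<^sup>2 + (q z)\<^sup>2 = (M - 2) * M"
    using W_square[of z] by (simp add: M_def power2_eq_square algebra_simps)
  have ab: "a\<^sup>2 + b\<^sup>2 = M\<^sup>2 * (1 + (q z)\<^sup>2)" "b\<^sup>2 + c\<^sup>2 = M\<^sup>2 * (1 + (p z)\<^sup>2)" "b * (a + c) = - (p z * q z * M\<^sup>2)"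
    using MW unfolding a_def b_def c_def by algebra+
  have "(W z * M * P1 - p z * (p z * P1 + q z * Q1)) + (W z * M * Q2 - q z * (p z * P2 + q z * Q2))
    = a * P1 + b * P2 + b * Q1 + c * Q2"
    unfolding WM by (simp add: a_def b_def c_def power2_eq_square algebra_simps)
  also have "\<dots> = r z * (a\<^sup>2 + b\<^sup>2) + 2 * s z * (b * (a + c)) + t z * (b\<^sup>2 + c\<^sup>2)"
    by (simp add: P1_def Q1_def P2_def Q2_def algebra_simps power2_eq_square)
  also have "\<dots> = M\<^sup>2 * ((1 + (q z)\<^sup>2) * r z - 2 * p z * q z * s z + (1 + (p z)\<^sup>2) * t z)"
    unfolding ab by (simp add: algebra_simps)
  also have "\<dots> = 0" using mse[OF z] by simp
  finally have e2: "- (W z * M * Q2 - q z * (p z * P2 + q z * Q2)) = W z * M * P1 - p z * (p z * P1 + q z * Q1)"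
    by simp
  have comp: "Re (Z' z 1) = a / M\<^sup>2" "Im (Z' z 1) = b / M\<^sup>2" "Re (Z' z \<i>) = b / M\<^sup>2" "Im (Z' z \<i>) = c / M\<^sup>2"
    by (simp_all add: Z'_components a_def b_def c_def M_def)
  have PQ: "r z * (a / M\<^sup>2) + s z * (b / M\<^sup>2) = P1 / M\<^sup>2" "s z * (a / M\<^sup>2) + t z * (b / M\<^sup>2) = Q1 / M\<^sup>2"
    "r z * (b / M\<^sup>2) + s z * (c / M\<^sup>2) = P2 / M\<^sup>2" "s z * (b / M\<^sup>2) + t z * (c / M\<^sup>2) = Q2 / M\<^sup>2"
    by (simp_all add: P1_def Q1_def P2_def Q2_def add_divide_distrib)
  have frac: "y / M\<^sup>2 / M - k * ((p z * (u / M\<^sup>2) + q z * (v / M\<^sup>2)) / W z) / M\<^sup>2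
     = (W z * M * y - k * (p z * u + q z * v)) / (W z * M ^ 4)" for y k u v
    using ne by (simp add: field_simps power2_eq_square power4_eq_xxxx)
  note eq = has_derivative_unique[OF D deriv_g[OF z], folded M_def]
  show ?thesis unfolding eq comp PQ frac complex_eq_iff minus_divide_left
    by (simp only: e1 e2[symmetric] complex.sel times_complex.sel) (simp add: diff_divide_distrib)
qed

text \<open>\<open>\<Xi>' z\<close> is the identity plus a positive definite matrix. Hence the
  component of \<open>\<Xi>\<close> along a segment grows at least as fast as arc length, and
  Cauchy-Schwarz gives expansion.\<close>

lemma lewy_map:
  obtains \<Xi> \<Xi>' where "\<And>z. z \<in> S \<Longrightarrow> (\<Xi> has_derivative \<Xi>' z) (at z)"
    "\<And>z v. z \<in> S \<Longrightarrow> Z' z (\<Xi>' z v) = v"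
    "\<And>x y. x \<in> S \<Longrightarrow> y \<in> S \<Longrightarrow> dist x y \<le> dist (\<Xi> x) (\<Xi> y)"
proof -
  obtain F G where
    F: "\<And>z. z \<in> S \<Longrightarrow> (F has_derivative (\<lambda>v. ((1 + (p z)\<^sup>2) / W z) * Re v + (p z * q z / W z) * Im v)) (at z)" and
    G: "\<And>z. z \<in> S \<Longrightarrow> (G has_derivative (\<lambda>v. (p z * q z / W z) * Re v + ((1 + (q z)\<^sup>2) / W z) * Im v)) (at z)"
    by (rule lewy_potentials) blast
  define \<Xi> where "\<Xi> z = z + of_real (F z) + \<i> * of_real (G z)" for z
  define \<Xi>' where "\<Xi>' z v = v + of_real (((1 + (p z)\<^sup>2) / W z) * Re v + (p z * q z / W z) * Im v)
     + \<i> * of_real ((p z * q z / W z) * Re v + ((1 + (q z)\<^sup>2) / W z) * Im v)" for z v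
  have der: "(\<Xi> has_derivative \<Xi>' z) (at z)" if "z \<in> S" for z
    unfolding \<Xi>_def[abs_def] \<Xi>'_def[abs_def]
    by (intro derivative_intros F G that)
  have inv: "Z' z (\<Xi>' z v) = v" for z v
  proof -
    define M where "M = 1 + W z"
    have ne: "M \<noteq> 0" "W z \<noteq> 0" using W_pos[of z] unfolding M_def by linarith+
    have W2: "(p z)\<^sup>2 = (W z)\<^sup>2 - 1 - (q z)\<^sup>2" using W_square[of z] by simp
    have "Re (\<Xi>' z v) = ((M + (p z)\<^sup>2) * Re v + p z * q z * Im v) / W z"
      "Im (\<Xi>' z v) = (p z * q z * Re v + (M + (q z)\<^sup>2) * Im v) / W z"
      using ne by (simp_all add: \<Xi>'_def M_def field_simps)
    note comps = Z'_components[of z "\<Xi>' z v", unfolded this, folded M_def]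
    \<comment> \<open>The determinant of \<open>W z\<close> times the matrix of
      \<open>\<Xi>' z\<close>, which makes the product with \<open>Z' z\<close> collapse to the
      identity. It is recorded in the two orders of factors in which it occurs.\<close>
    have num: "(M + (q z)\<^sup>2) * (M + (p z)\<^sup>2) - (p z)\<^sup>2 * (q z)\<^sup>2 = W z * M\<^sup>2"
      "(M + (p z)\<^sup>2) * (M + (q z)\<^sup>2) - (p z)\<^sup>2 * (q z)\<^sup>2 = W z * M\<^sup>2"
      unfolding M_def W2 by (simp_all add: power2_eq_square algebra_simps)
    have "Re (Z' z (\<Xi>' z v)) = ((M + (q z)\<^sup>2) * (M + (p z)\<^sup>2) - (p z)\<^sup>2 * (q z)\<^sup>2) * Re v / (W z * M\<^sup>2)"
      unfolding comps using ne by (simp add: field_simps power2_eq_square)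
    moreover have "Im (Z' z (\<Xi>' z v)) = ((M + (p z)\<^sup>2) * (M + (q z)\<^sup>2) - (p z)\<^sup>2 * (q z)\<^sup>2) * Im v / (W z * M\<^sup>2)"
      unfolding comps using ne by (simp add: field_simps power2_eq_square)
    ultimately show ?thesis
      unfolding num using ne by (simp add: complex_eq_iff)
  qed
  have mono: "\<Xi>' z v \<bullet> v \<ge> v \<bullet> v" for z v
  proof -
    have "\<Xi>' z v \<bullet> v - v \<bullet> v = ((Re v)\<^sup>2 + (Im v)\<^sup>2 + (p z * Re v + q z * Im v)\<^sup>2) / W z"
      by (simp add: \<Xi>'_def inner_complex_def power2_eq_square algebra_simps add_divide_distrib)
    also have "\<dots> \<ge> 0" using W_pos[of z] by simp
    finally show ?thesis by simp
  qed
  have exp: "dist x y \<le> dist (\<Xi> x) (\<Xi> y)" if "x \<in> S" "y \<in> S" for x y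
  proof (cases "x = y")
    case False
    define v where "v = y - x"
    define h where "h \<tau> = \<Xi> (x + \<tau> *\<^sub>R v) \<bullet> v" for \<tau> :: real
    have inS: "x + \<tau> *\<^sub>R v \<in> S" if "0 \<le> \<tau>" "\<tau> \<le> 1" for \<tau>
    proof -
      have "x + \<tau> *\<^sub>R v = (1 - \<tau>) *\<^sub>R x + \<tau> *\<^sub>R y" by (simp add: v_def algebra_simps)
      then show ?thesis using convexD_alt[OF convex_domain \<open>x \<in> S\<close> \<open>y \<in> S\<close> that] by simp
    qed
    have dh: "(h has_derivative (\<lambda>k. \<Xi>' (x + \<tau> *\<^sub>R v) (k *\<^sub>R v) \<bullet> v)) (at \<tau>)" if "0 \<le> \<tau>" "\<tau> \<le> 1" for \<tau>
    proof -
      have l: "((\<lambda>\<tau>. x + \<tau> *\<^sub>R v) has_derivative (\<lambda>k. k *\<^sub>R v)) (at \<tau>)"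
        by (auto intro!: derivative_eq_intros)
      show ?thesis
        unfolding h_def
        by (rule has_derivative_inner_left, rule has_derivative_compose[OF l, of \<Xi>], rule der[OF inS[OF that]])
    qed
    obtain \<tau> where "h 1 - h 0 = \<Xi>' (x + \<tau> *\<^sub>R v) ((1 - 0) *\<^sub>R v) \<bullet> v"
      using mvt_simple[OF zero_less_one, of h "\<lambda>\<tau> k. \<Xi>' (x + \<tau> *\<^sub>R v) (k *\<^sub>R v) \<bullet> v"]
        dh[THEN has_derivative_at_withinI] by blast
    then have "v \<bullet> v \<le> h 1 - h 0" using mono by simp
    also have "\<dots> = (\<Xi> y - \<Xi> x) \<bullet> v" by (simp add: h_def v_def inner_diff_left)
    also have "\<dots> \<le> norm (\<Xi> y - \<Xi> x) * norm v" by (rule norm_cauchy_schwarz)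
    finally have "norm v * norm v \<le> norm (\<Xi> y - \<Xi> x) * norm v"
      by (simp add: norm_eq_square power2_norm_eq_inner[symmetric] power2_eq_square)
    moreover have "norm v > 0" using False by (simp add: v_def)
    ultimately show ?thesis by (simp add: v_def dist_norm norm_minus_commute)
  qed simp
  show ?thesis using that der inv exp by blast
qed

text \<open>\<open>Z\<close> is the inverse of the translated map \<open>\<Xi> - \<Xi> c\<close>.
  Expansion of \<open>\<Xi>\<close> makes it available on the whole disc of the same radius
  \<open>R\<close>, and 1-Lipschitz there; its differential is \<open>Z'\<close>, so the
  Cauchy-Riemann equations apply to \<open>g\<close> composed with \<open>Z\<close>.\<close>

lemma conformal_parametrization:
  assumes R: "0 < R" and sub: "ball c R \<subseteq> S"
  obtains Z where "Z 0 = c" "\<And>\<zeta>. \<zeta> \<in> ball 0 R \<Longrightarrow> Z \<zeta> \<in> ball c R"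
    "\<And>\<zeta>. \<zeta> \<in> ball 0 R \<Longrightarrow> (Z has_derivative Z' (Z \<zeta>)) (at \<zeta>)"
    "\<And>x y. x \<in> ball 0 R \<Longrightarrow> y \<in> ball 0 R \<Longrightarrow> dist (Z x) (Z y) \<le> dist x y"
    "(\<lambda>\<zeta>. g (Z \<zeta>)) holomorphic_on ball 0 R"
proof -
  obtain \<Xi> \<Xi>' where der: "\<And>z. z \<in> S \<Longrightarrow> (\<Xi> has_derivative \<Xi>' z) (at z)"
    and inv: "\<And>z v. z \<in> S \<Longrightarrow> Z' z (\<Xi>' z v) = v"
    and exp: "\<And>x y. x \<in> S \<Longrightarrow> y \<in> S \<Longrightarrow> dist x y \<le> dist (\<Xi> x) (\<Xi> y)"
    by (rule lewy_map) blast
  have "continuous_on (ball c R) \<Xi>"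
    by (meson continuous_at_imp_continuous_on der has_derivative_continuous sub subsetD)
  then have surj: "ball (\<Xi> c) R \<subseteq> \<Xi> ` ball c R"
    by (rule ball_subset_expanding_image) (use exp sub in blast)
  define Z where "Z \<zeta> = inv_into (ball c R) \<Xi> (\<Xi> c + \<zeta>)" for \<zeta>
  have mem: "\<Xi> c + \<zeta> \<in> \<Xi> ` ball c R" if "\<zeta> \<in> ball 0 R" for \<zeta>
    using that surj by (auto simp: dist_norm subset_iff)
  have Zin: "Z \<zeta> \<in> ball c R" and \<Xi>Z: "\<Xi> (Z \<zeta>) = \<Xi> c + \<zeta>" if "\<zeta> \<in> ball 0 R" for \<zeta>
    unfolding Z_def using mem[OF that] by (auto intro: inv_into_into f_inv_into_f simp del: mem_ball)
  have Z0: "Z 0 = c"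
  proof -
    have "dist (Z 0) c \<le> dist (\<Xi> (Z 0)) (\<Xi> c)" using Zin[of 0] sub R by (intro exp) (auto simp: subset_iff)
    then show ?thesis using \<Xi>Z[of 0] R by simp
  qed
  have lip: "dist (Z x) (Z y) \<le> dist x y" if "x \<in> ball 0 R" "y \<in> ball 0 R" for x y
    using exp[of "Z x" "Z y"] subsetD[OF sub Zin[OF that(1)]] subsetD[OF sub Zin[OF that(2)]] \<Xi>Z that by simp
  have derZ: "(Z has_derivative Z' (Z \<zeta>)) (at \<zeta>)" if z: "\<zeta> \<in> ball 0 R" for \<zeta>
  proof (rule has_derivative_inverse_basic)
    show "((\<lambda>z. \<Xi> z - \<Xi> c) has_derivative \<Xi>' (Z \<zeta>)) (at (Z \<zeta>))"
      using der[of "Z \<zeta>"] Zin[OF z] sub by (auto intro!: derivative_eq_intros)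
    show "Z' (Z \<zeta>) \<circ> \<Xi>' (Z \<zeta>) = id"
      using inv[of "Z \<zeta>"] Zin[OF z] sub by (auto simp: fun_eq_iff)
    have "continuous_on (ball 0 R) Z"
      unfolding continuous_on_iff using lip by (meson order_le_less_trans)
    then show "continuous (at \<zeta>) Z" using z by (simp add: continuous_on_eq_continuous_at)
    show "\<Xi> (Z y) - \<Xi> c = y" if "y \<in> ball 0 R" for y using \<Xi>Z[OF that] by simp
  qed (use z in \<open>auto simp: bounded_linear_Z'\<close>)
  have "(\<lambda>\<zeta>. g (Z \<zeta>)) field_differentiable at \<zeta>" if z: "\<zeta> \<in> ball 0 R" for \<zeta>
  proof -
    have zS: "Z \<zeta> \<in> S" using Zin[OF z] sub by blast
    then obtain D where D: "(g has_derivative D) (at (Z \<zeta>))" using deriv_g by blast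
    have comp: "((\<lambda>\<zeta>. g (Z \<zeta>)) has_derivative (\<lambda>v. D (Z' (Z \<zeta>) v))) (at \<zeta>)"
      by (rule has_derivative_compose[OF derZ[OF z] D])
    let ?L = "\<lambda>v. D (Z' (Z \<zeta>) v)"
    interpret L: bounded_linear ?L using comp by (rule has_derivative_bounded_linear)
    \<comment> \<open>A real-linear map that commutes with \<open>\<i>\<close> at 1 is
      multiplication by its value at 1.\<close>
    have "?L v = ?L 1 * v" for v
    proof -
      have "v = Re v *\<^sub>R 1 + Im v *\<^sub>R \<i>" by (simp add: complex_eq_iff)
      then have "?L v = ?L (Re v *\<^sub>R 1 + Im v *\<^sub>R \<i>)" by (rule arg_cong)
      also have "\<dots> = Re v *\<^sub>R ?L 1 + Im v *\<^sub>R (\<i> * ?L 1)"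
        unfolding L.add L.scaleR cauchy_riemann_g[OF zS D] ..
      also have "\<dots> = ?L 1 * (of_real (Re v) + \<i> * of_real (Im v))"
        by (simp add: scaleR_conv_of_real algebra_simps)
      also have "\<dots> = ?L 1 * v" by (simp add: complex_eq[symmetric])
      finally show ?thesis .
    qed
    then have "?L = (*) (?L 1)" by blast
    with comp show ?thesis
      unfolding field_differentiable_def has_field_derivative_def by metis
  qed
  then have "(\<lambda>\<zeta>. g (Z \<zeta>)) holomorphic_on ball 0 R"
    by (simp add: holomorphic_on_open[OF open_ball] field_differentiable_def)
  then show ?thesis using that[of Z] Z0 Zin derZ lip by blast
qed

section \<open>The conjugate function in conformal coordinates\<close>

text \<open>Rotating source and target by \<open>N\<close> replaces \<open>g\<close> by
  \<open>h = N * g\<close>. For \<open>h = 1\<close> the right side is purely imaginary: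
  \<open>Z\<close> then moves only along \<open>\<i> * N\<close>.\<close>

lemma Z'_rotated:
  assumes "norm N = 1"
  shows "cnj N * Z' z (N * w) = (w - cnj ((N * g z)\<^sup>2 * w)) / 2"
proof -
  have "cnj N * Z' z (N * w) = ((cnj N * N) * w - cnj N * cnj ((g z)\<^sup>2 * (N * w))) / 2"
    by (simp add: Z'_def algebra_simps)
  also have "cnj N * cnj ((g z)\<^sup>2 * (N * w)) = cnj ((N * g z)\<^sup>2 * w)"
    by (simp add: power2_eq_square algebra_simps)
  finally show ?thesis by (simp add: cnj_mult_self_unit[OF assms])
qed

text \<open>In the conformal coordinate the stream function is thus the imaginary part of a
  primitive of the holomorphic function \<open>g\<close>.\<close>

lemma stream_function_Z':
  "(p z * Im (Z' z v) - q z * Re (Z' z v)) / W z = Im (g z * v)"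
proof -
  define M where "M = 1 + W z"
  have ne: "M \<noteq> 0" "W z \<noteq> 0" using W_pos[of z] unfolding M_def by linarith+
  have "(M + (p z)\<^sup>2) + (q z)\<^sup>2 = W z * M"
    using W_square[of z] by (simp add: M_def power2_eq_square algebra_simps)
  then have num: "p z * ((M + (p z)\<^sup>2) * Im v - p z * q z * Re v) - q z * ((M + (q z)\<^sup>2) * Re v - p z * q z * Im v)
     = W z * M * (p z * Im v - q z * Re v)" by algebra
  have "(p z * Im (Z' z v) - q z * Re (Z' z v)) / W z
     = (p z * ((M + (p z)\<^sup>2) * Im v - p z * q z * Re v) - q z * ((M + (q z)\<^sup>2) * Re v - p z * q z * Im v)) / M\<^sup>2 / W z"
    unfolding Z'_components M_def[symmetric] by (simp only: times_divide_eq_right diff_divide_distrib[symmetric])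
  also have "\<dots> = (p z * Im v - q z * Re v) / M"
    unfolding num using ne by (simp add: power2_eq_square)
  also have "\<dots> = Im (g z * v)"
    by (simp add: g_components M_def diff_divide_distrib)
  finally show ?thesis .
qed

text \<open>The gradient of \<open>\<psi>\<close> is that of the height rotated and divided by
  \<open>W\<close>, so its length is \<open>sqrt (p^2 + q^2) / W\<close>, below 1.\<close>

lemma stream_function_lipschitz:
  assumes \<psi>: "\<And>z. z \<in> S \<Longrightarrow> (\<psi> has_derivative (\<lambda>v. (p z * Im v - q z * Re v) / W z)) (at z)"
    and "x \<in> S" "y \<in> S"
  shows "\<bar>\<psi> x - \<psi> y\<bar> \<le> dist x y"
proof -
  have "norm (\<psi> x - \<psi> y) \<le> 1 * norm (x - y)"
  proof (rule differentiable_bound[OF convex_domain])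
    fix z assume z: "z \<in> S"
    show "(\<psi> has_derivative (\<lambda>v. (p z * Im v - q z * Re v) / W z)) (at z within S)"
      using \<psi>[OF z] by (rule has_derivative_at_withinI)
    show "onorm (\<lambda>v. (p z * Im v - q z * Re v) / W z) \<le> 1"
    proof (rule onorm_le)
      fix v
      have "(p z * Im v - q z * Re v)\<^sup>2 = ((p z)\<^sup>2 + (q z)\<^sup>2) * (norm v)\<^sup>2 - (p z * Re v + q z * Im v)\<^sup>2"
        unfolding cmod_power2 by (simp add: power2_eq_square algebra_simps)
      also have "\<dots> \<le> (W z)\<^sup>2 * (norm v)\<^sup>2"
        unfolding W_square by (simp add: algebra_simps)
      finally have "\<bar>p z * Im v - q z * Re v\<bar> \<le> W z * norm v"
        using W_pos[of z] by (metis abs_le_square_iff abs_of_nonneg less_imp_le mult_nonneg_nonneg norm_ge_zero power_mult_distrib)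
      then show "norm ((p z * Im v - q z * Re v) / W z) \<le> 1 * norm v"
        using W_pos[of z] by (simp add: divide_le_eq mult.commute)
    qed
  qed (use assms in auto)
  then show ?thesis by (simp add: dist_norm)
qed

lemma Re_one_minus_rotated_g_pos:
  assumes "norm N = 1"
  shows "0 < Re (1 - N * g z)"
proof -
  have "Re (N * g z) \<le> norm (N * g z)" by (rule complex_Re_le_cmod)
  also have "\<dots> < 1" using norm_g_less_1[of z] assms by (simp add: norm_mult)
  finally show ?thesis by simp
qed

section \<open>Quantitative propagation of the Gauss map\<close>

text \<open>The curve \<open>Z (l t)\<close> is compared with the line \<open>c + l t\<close>. The
  curve drifts from the line by at most \<open>3 * \<epsilon> * \<bar>\<tau>\<bar>\<close>, and
  \<open>\<psi>\<close> along the curve deviates from growth at rate 1 by as much; the Lipschitz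
  bound adds the two errors.\<close>

lemma stream_function_along_normal_line:
  assumes R: "0 < R" and sub: "ball c R \<subseteq> S" and N: "norm N = 1"
    and \<psi>: "\<And>z. z \<in> S \<Longrightarrow> (\<psi> has_derivative (\<lambda>v. (p z * Im v - q z * Re v) / W z)) (at z)"
    and \<tau>: "\<bar>\<tau>\<bar> \<le> R / 2"
  shows "\<bar>\<psi> (c + \<tau> *\<^sub>R (\<i> * N)) - \<psi> c - \<tau>\<bar> \<le> 6 * norm (1 - N * g c) * \<bar>\<tau>\<bar>"
proof -
  define \<epsilon> where "\<epsilon> = norm (1 - N * g c)"
  obtain Z where Z0: "Z 0 = c" and Zin: "\<And>\<zeta>. \<zeta> \<in> ball 0 R \<Longrightarrow> Z \<zeta> \<in> ball c R"
    and dZ: "\<And>\<zeta>. \<zeta> \<in> ball 0 R \<Longrightarrow> (Z has_derivative Z' (Z \<zeta>)) (at \<zeta>)"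
    and hol: "(\<lambda>\<zeta>. g (Z \<zeta>)) holomorphic_on ball 0 R"
    by (rule conformal_parametrization[OF R sub]) blast
  \<comment> \<open>On the half disc the Harnack factor is at most 2, so \<open>\<epsilon>\<close>
    grows to at most \<open>\<epsilon> + 2 * \<epsilon>\<close>.\<close>
  have small: "norm (1 - N * g (Z \<zeta>)) \<le> 3 * \<epsilon>" if \<zeta>: "norm \<zeta> \<le> R / 2" for \<zeta>
  proof -
    have "norm ((1 - N * g (Z \<zeta>)) - (1 - N * g (Z 0))) \<le> 2 * norm \<zeta> / (R - norm \<zeta>) * Re (1 - N * g (Z 0))"
      using Re_one_minus_rotated_g_pos[OF N] \<zeta> R
      by (intro positive_real_part_deviation holomorphic_intros hol) auto
    also have "\<dots> \<le> 2 * \<epsilon>"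
    proof (rule mult_mono)
      show "2 * norm \<zeta> / (R - norm \<zeta>) \<le> 2" using \<zeta> R by (simp add: divide_le_eq)
      show "Re (1 - N * g (Z 0)) \<le> \<epsilon>" unfolding \<epsilon>_def Z0 by (rule complex_Re_le_cmod)
    qed (use Re_one_minus_rotated_g_pos[OF N, of "Z 0"] in auto)
    finally show ?thesis
      using norm_triangle_ineq2[of "1 - N * g (Z \<zeta>)" "1 - N * g (Z 0)"] unfolding \<epsilon>_def Z0 by linarith
  qed
  define I where "I = {- R / 2 .. R / 2}"
  have I: "convex I" "\<tau> \<in> I" "0 \<in> I" using \<tau> R by (auto simp: I_def abs_le_iff)
  define l where "l t = t *\<^sub>R (\<i> * N)" for t :: real
  have nl: "norm (l t) = \<bar>t\<bar>" for t by (simp add: l_def norm_mult N)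
  have lball: "l t \<in> ball 0 R" "norm (l t) \<le> R / 2" if "t \<in> I" for t
    using that R unfolding I_def mem_ball dist_0_norm nl atLeastAtMost_iff by linarith+
  have dl: "(l has_derivative (\<lambda>k. k *\<^sub>R (\<i> * N))) (at t within I)" for t
    unfolding l_def by (auto intro!: derivative_eq_intros)
  have dZl: "((\<lambda>t. Z (l t)) has_derivative (\<lambda>k. Z' (Z (l t)) (k *\<^sub>R (\<i> * N)))) (at t within I)" if "t \<in> I" for t
    by (rule has_derivative_compose[OF dl dZ[OF lball(1)[OF that]]])
  have "norm ((Z (l \<tau>) - l \<tau>) - (Z (l 0) - l 0)) \<le> 3 * \<epsilon> * norm (\<tau> - 0)"
  proof (rule differentiable_bound[OF I(1)])
    fix t assume t: "t \<in> I"
    show "((\<lambda>t. Z (l t) - l t) has_derivative (\<lambda>k. Z' (Z (l t)) (k *\<^sub>R (\<i> * N)) - k *\<^sub>R (\<i> * N))) (at t within I)"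
      by (intro derivative_intros dZl dl t)
    show "onorm (\<lambda>k. Z' (Z (l t)) (k *\<^sub>R (\<i> * N)) - k *\<^sub>R (\<i> * N)) \<le> 3 * \<epsilon>"
    proof (rule onorm_le)
      fix k :: real
      let ?h = "N * g (Z (l t))"
      have kN: "k *\<^sub>R (\<i> * N) = N * (of_real k * \<i>)" by (simp add: scaleR_conv_of_real)
      have "norm (Z' (Z (l t)) (k *\<^sub>R (\<i> * N)) - k *\<^sub>R (\<i> * N))
         = norm (cnj N * (Z' (Z (l t)) (N * (of_real k * \<i>)) - N * (of_real k * \<i>)))"
        by (simp add: kN norm_mult N)
      also have "cnj N * (Z' (Z (l t)) (N * (of_real k * \<i>)) - N * (of_real k * \<i>))
         = cnj N * Z' (Z (l t)) (N * (of_real k * \<i>)) - (cnj N * N) * (of_real k * \<i>)"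
        by (simp add: algebra_simps)
      \<comment> \<open>The velocity error contains \<open>1 - ?h^2\<close>, factored so that
        \<open>1 - ?h\<close> is small while \<open>1 + ?h\<close> is bounded by 2.\<close>
      also have "\<dots> = - (of_real k * \<i> * cnj ((1 - ?h) * (1 + ?h)) / 2)"
        unfolding Z'_rotated[OF N] cnj_mult_self_unit[OF N] by (simp add: field_simps power2_eq_square)
      also have "norm \<dots> = \<bar>k\<bar> * (norm (1 - ?h) * norm (1 + ?h)) / 2"
        by (simp add: norm_mult norm_divide del: complex_cnj_mult)
      also have "\<dots> \<le> \<bar>k\<bar> * (3 * \<epsilon> * 2) / 2"
      proof (intro divide_right_mono mult_left_mono mult_mono)
        show "norm (1 - ?h) \<le> 3 * \<epsilon>" by (rule small[OF lball(2)[OF t]])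
        have "norm (1 + ?h) \<le> norm (1::complex) + norm ?h" by (rule norm_triangle_ineq)
        then show "norm (1 + ?h) \<le> 2" using norm_g_less_1[of "Z (l t)"] N by (simp add: norm_mult)
      qed (auto simp: \<epsilon>_def)
      finally show "norm (Z' (Z (l t)) (k *\<^sub>R (\<i> * N)) - k *\<^sub>R (\<i> * N)) \<le> 3 * \<epsilon> * norm k" by simp
    qed
  qed (use I in auto)
  then have distZ: "dist (c + l \<tau>) (Z (l \<tau>)) \<le> 3 * \<epsilon> * \<bar>\<tau>\<bar>"
    by (simp add: l_def Z0 dist_norm norm_minus_commute algebra_simps)
  have "norm ((\<psi> (Z (l \<tau>)) - \<tau>) - (\<psi> (Z (l 0)) - 0)) \<le> 3 * \<epsilon> * norm (\<tau> - 0)"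
  proof (rule differentiable_bound[OF I(1)])
    fix t assume t: "t \<in> I"
    have zS: "Z (l t) \<in> S" using Zin[OF lball(1)[OF t]] sub by blast
    have "((\<lambda>t. \<psi> (Z (l t))) has_derivative (\<lambda>k. Im (g (Z (l t)) * (k *\<^sub>R (\<i> * N))))) (at t within I)"
      using has_derivative_compose[OF dZl[OF t] \<psi>[OF zS]] unfolding stream_function_Z' .
    then show "((\<lambda>t. \<psi> (Z (l t)) - t) has_derivative (\<lambda>k. Im (g (Z (l t)) * (k *\<^sub>R (\<i> * N))) - k)) (at t within I)"
      by (intro derivative_intros)
    show "onorm (\<lambda>k. Im (g (Z (l t)) * (k *\<^sub>R (\<i> * N))) - k) \<le> 3 * \<epsilon>"
    proof (rule onorm_le)
      fix k :: real
      have "Im (g (Z (l t)) * (k *\<^sub>R (\<i> * N))) - k = - k * Re (1 - N * g (Z (l t)))"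
        by (simp add: algebra_simps)
      then have "norm (Im (g (Z (l t)) * (k *\<^sub>R (\<i> * N))) - k) = \<bar>k\<bar> * \<bar>Re (1 - N * g (Z (l t)))\<bar>"
        by (simp add: abs_mult)
      also have "\<dots> \<le> \<bar>k\<bar> * (3 * \<epsilon>)"
        using small[OF lball(2)[OF t]] abs_Re_le_cmod[of "1 - N * g (Z (l t))"] by (intro mult_left_mono) auto
      finally show "norm (Im (g (Z (l t)) * (k *\<^sub>R (\<i> * N))) - k) \<le> 3 * \<epsilon> * norm k" by (simp add: mult.commute)
    qed
  qed (use I in auto)
  then have "\<bar>\<psi> (Z (l \<tau>)) - \<psi> c - \<tau>\<bar> \<le> 3 * \<epsilon> * \<bar>\<tau>\<bar>"
    by (simp add: l_def Z0 algebra_simps)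
  moreover have "\<bar>\<psi> (c + l \<tau>) - \<psi> (Z (l \<tau>))\<bar> \<le> dist (c + l \<tau>) (Z (l \<tau>))"
  proof (rule stream_function_lipschitz[OF \<psi>])
    show "Z (l \<tau>) \<in> S" using Zin[OF lball(1)[OF I(2)]] sub by blast
    have "c + l \<tau> \<in> ball c R" using lball(1)[OF I(2)] by (simp add: dist_norm)
    then show "c + l \<tau> \<in> S" using sub by blast
  qed
  ultimately show ?thesis using distZ unfolding \<epsilon>_def l_def by linarith
qed

theorem gauss_map_propagation:
  assumes R: "0 < R" and sub: "ball c R \<subseteq> S" and N: "norm N = 1" and \<sigma>: "\<bar>\<sigma>\<bar> \<le> R / 8"
  shows "norm (1 - N * g (c + \<sigma> *\<^sub>R (\<i> * N))) ^ 4 \<le> 1200 * norm (1 - N * g c)"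
proof -
  define \<epsilon> where "\<epsilon> = norm (1 - N * g c)"
  define Q where "Q = c + \<sigma> *\<^sub>R (\<i> * N)"
  \<comment> \<open>A reference point behind \<open>Q\<close> on the same line, at distance
    \<open>d\<close> from it. The bound on \<open>\<sigma>\<close> keeps \<open>d\<close> at least
    \<open>R / 8\<close>.\<close>
  define A where "A = c + (- (R / 4)) *\<^sub>R (\<i> * N)"
  define \<kappa> where "\<kappa> = 1 - N * g Q"
  define \<eta> where "\<eta> = norm \<kappa>"
  define d where "d = \<sigma> + R / 4"
  have \<epsilon>0: "\<epsilon> \<ge> 0" and \<eta>0: "\<eta> \<ge> 0" by (simp_all add: \<epsilon>_def \<eta>_def)
  have d: "R / 8 \<le> d" using \<sigma> unfolding d_def by linarith
  have \<eta>2: "\<eta> \<le> 2"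
    unfolding \<eta>_def \<kappa>_def using norm_triangle_ineq4[of 1 "N * g Q"] norm_g_less_1[of Q] N by (simp add: norm_mult)
  obtain \<psi> where \<psi>: "\<And>z. z \<in> S \<Longrightarrow> (\<psi> has_derivative (\<lambda>v. (p z * Im v - q z * Re v) / W z)) (at z)"
    by (rule stream_function) blast
  have "\<bar>\<psi> Q - \<psi> c - \<sigma>\<bar> \<le> 6 * \<epsilon> * \<bar>\<sigma>\<bar>"
    unfolding Q_def \<epsilon>_def by (rule stream_function_along_normal_line[OF R sub N \<psi>]) (use \<sigma> R in linarith)+
  moreover have "\<bar>\<psi> A - \<psi> c - (- (R / 4))\<bar> \<le> 6 * \<epsilon> * \<bar>- (R / 4)\<bar>"
    unfolding A_def \<epsilon>_def by (rule stream_function_along_normal_line[OF R sub N \<psi>]) (use R in linarith)+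
  moreover have "6 * \<epsilon> * \<bar>\<sigma>\<bar> \<le> 6 * \<epsilon> * (R / 8)" using \<sigma> \<epsilon>0 by (intro mult_left_mono) auto
  moreover have "6 * \<epsilon> * \<bar>- (R / 4)\<bar> = 6 * \<epsilon> * (R / 4)" using R by simp
  \<comment> \<open>The loss is \<open>6 * \<epsilon> * (R/8 + R/4)\<close>: from \<open>A\<close>
    to \<open>Q\<close> the function \<open>\<psi>\<close> nearly exhausts its Lipschitz
    bound.\<close>
  ultimately have QA: "\<psi> Q - \<psi> A \<ge> d - 9/4 * (\<epsilon> * R)" unfolding d_def by argo
  show ?thesis
  proof (cases "\<eta> = 0")
    case False
    then have \<eta>: "\<eta> > 0" using \<eta>0 by simp
    \<comment> \<open>Chosen so that the second-order cost \<open>r^2 / d\<close>, at most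
      \<open>8 * r^2 / R = r * \<eta>^2 / 10\<close>, stays below the gain
      \<open>r * \<eta>^2 / 4\<close>.\<close>
    define r where "r = \<eta>\<^sup>2 * R / 80"
    have r0: "r > 0" using \<eta> R by (simp add: r_def)
    have "\<eta>\<^sup>2 \<le> 2\<^sup>2" using \<eta>2 \<eta>0 by (rule power_mono)
    then have rR: "r \<le> R / 20" using R by (simp add: r_def)
    have R2: "0 < R / 2" using R by simp
    have Qsub: "ball Q (R / 2) \<subseteq> ball c R"
    proof
      fix x assume "x \<in> ball Q (R / 2)"
      moreover have "dist c Q = \<bar>\<sigma>\<bar>" by (simp add: Q_def dist_norm norm_mult N)
      moreover have "dist c x \<le> dist c Q + dist Q x" by (rule dist_triangle)
      ultimately show "x \<in> ball c R" using \<sigma> R by simp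
    qed
    obtain Z where Z0: "Z 0 = Q" and Zin: "\<And>\<zeta>. \<zeta> \<in> ball 0 (R / 2) \<Longrightarrow> Z \<zeta> \<in> ball Q (R / 2)"
      and dZ: "\<And>\<zeta>. \<zeta> \<in> ball 0 (R / 2) \<Longrightarrow> (Z has_derivative Z' (Z \<zeta>)) (at \<zeta>)"
      and lip: "\<And>x y. x \<in> ball 0 (R / 2) \<Longrightarrow> y \<in> ball 0 (R / 2) \<Longrightarrow> dist (Z x) (Z y) \<le> dist x y"
      and hol: "(\<lambda>\<zeta>. g (Z \<zeta>)) holomorphic_on ball 0 (R / 2)"
      using conformal_parametrization[OF R2 subset_trans[OF Qsub sub]] by metis
    \<comment> \<open>the direction in which \<^emph>\<open>- Im ((1 - h)^2 w)\<close> is largest at \<^emph>\<open>Q\<close>\<close>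
    define w where "w = - \<i> * cnj (\<kappa>\<^sup>2) / of_real (\<eta>\<^sup>2)"
    have nw: "norm w = 1" using \<eta> by (simp add: w_def norm_mult norm_divide norm_power \<eta>_def)
    have \<kappa>w: "\<kappa>\<^sup>2 * w = - \<i> * of_real (\<eta>\<^sup>2)"
    proof -
      have "\<kappa>\<^sup>2 * cnj (\<kappa>\<^sup>2) = of_real ((\<eta>\<^sup>2)\<^sup>2)"
        by (simp only: complex_norm_square[symmetric] norm_power \<eta>_def)
      then show ?thesis using \<eta> by (simp add: w_def power2_eq_square field_simps)
    qed
    define l where "l t = t *\<^sub>R (N * w)" for t :: real
    have nl: "norm (l t) = \<bar>t\<bar>" for t by (simp add: l_def norm_mult N nw)
    have lb: "l t \<in> ball 0 (R / 2)" if "0 \<le> t" "t \<le> r" for t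
      using that rR R by (simp add: nl)
    \<comment> \<open>Since \<open>r\<close> is at most \<open>R / 20\<close>, the Harnack factor on
      the disc of radius \<open>R / 2\<close> is at most 2/9, and
      \<open>2/9 * (2/9 + 2) = 40/81\<close> is below 1/2.\<close>
    have osc: "norm ((1 - N * g (Z (l t)))\<^sup>2 - \<kappa>\<^sup>2) \<le> \<eta>\<^sup>2 / 2" if t: "0 \<le> t" "t \<le> r" for t
    proof -
      let ?k = "1 - N * g (Z (l t))"
      have "norm (?k - (1 - N * g (Z 0))) \<le> 2 * norm (l t) / (R / 2 - norm (l t)) * Re (1 - N * g (Z 0))"
        using Re_one_minus_rotated_g_pos[OF N] lb[OF t]
        by (intro positive_real_part_deviation holomorphic_intros hol) auto
      also have "\<dots> \<le> 2 / 9 * \<eta>"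
      proof (rule mult_mono)
        show "2 * norm (l t) / (R / 2 - norm (l t)) \<le> 2 / 9" using t rR R by (simp add: nl divide_le_eq)
        show "Re (1 - N * g (Z 0)) \<le> \<eta>" unfolding \<eta>_def \<kappa>_def Z0 by (rule complex_Re_le_cmod)
      qed (use Re_one_minus_rotated_g_pos[OF N, of "Z 0"] in auto)
      finally have k: "norm (?k - \<kappa>) \<le> 2 / 9 * \<eta>" by (simp add: \<kappa>_def Z0)
      have "?k\<^sup>2 - \<kappa>\<^sup>2 = (?k - \<kappa>) * ((?k - \<kappa>) + 2 * \<kappa>)" by (simp add: power2_eq_square algebra_simps)
      then have "norm (?k\<^sup>2 - \<kappa>\<^sup>2) = norm (?k - \<kappa>) * norm ((?k - \<kappa>) + 2 * \<kappa>)" by (simp add: norm_mult)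
      also have "\<dots> \<le> (2 / 9 * \<eta>) * (2 / 9 * \<eta> + 2 * \<eta>)"
      proof (intro mult_mono k)
        show "norm ((?k - \<kappa>) + 2 * \<kappa>) \<le> 2 / 9 * \<eta> + 2 * \<eta>"
          using norm_triangle_ineq[of "?k - \<kappa>" "2 * \<kappa>"] k by (simp add: norm_mult \<eta>_def)
      qed (use \<eta>0 in auto)
      also have "\<dots> \<le> \<eta>\<^sup>2 / 2" by (simp add: power2_eq_square)
      finally show ?thesis .
    qed
    \<comment> \<open>The excess of \<open>\<psi>\<close> over the displacement in direction
      \<open>\<i> * N\<close>. Its rate is \<open>\<eta>^2 / 2\<close> at \<open>Q\<close> by the
      choice of \<open>w\<close>, and at least half of that up to \<open>r\<close> by
      \<open>osc\<close>.\<close>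
    define m where "m t = \<psi> (Z (l t)) - Im (cnj N * Z (l t))" for t
    have dm: "(m has_derivative (\<lambda>k. k * (- Im ((1 - N * g (Z (l t)))\<^sup>2 * w) / 2))) (at t within {0..r})" if t: "0 \<le> t" "t \<le> r" for t
    proof -
      let ?h = "N * g (Z (l t))"
      have "(l has_derivative (\<lambda>k. k *\<^sub>R (N * w))) (at t within {0..r})"
        unfolding l_def by (auto intro!: derivative_eq_intros)
      note dZl = has_derivative_compose[OF this dZ[OF lb[OF t]]]
      have zS: "Z (l t) \<in> S" using Zin[OF lb[OF t]] Qsub sub by blast
      have "((\<lambda>t. \<psi> (Z (l t))) has_derivative (\<lambda>k. Im (g (Z (l t)) * (k *\<^sub>R (N * w))))) (at t within {0..r})"
        using has_derivative_compose[OF dZl \<psi>[OF zS]] unfolding stream_function_Z' .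
      then have "(m has_derivative (\<lambda>k. Im (g (Z (l t)) * (k *\<^sub>R (N * w))) - Im (cnj N * Z' (Z (l t)) (k *\<^sub>R (N * w))))) (at t within {0..r})"
        unfolding m_def by (intro derivative_intros dZl)
      moreover have "Im (g (Z (l t)) * (k *\<^sub>R (N * w))) - Im (cnj N * Z' (Z (l t)) (k *\<^sub>R (N * w))) = k * (- Im ((1 - ?h)\<^sup>2 * w) / 2)" for k
      proof -
        have kN: "k *\<^sub>R (N * w) = N * (of_real k * w)" by (simp add: scaleR_conv_of_real)
        have "Im (cnj N * Z' (Z (l t)) (k *\<^sub>R (N * w))) = (Im (of_real k * w) + Im (?h\<^sup>2 * (of_real k * w))) / 2"
          unfolding kN Z'_rotated[OF N] by (simp del: complex_cnj_mult)
        also have "\<dots> = k * Im ((1 + ?h\<^sup>2) * w) / 2" by (simp add: algebra_simps)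
        finally have "Im (cnj N * Z' (Z (l t)) (k *\<^sub>R (N * w))) = k * Im ((1 + ?h\<^sup>2) * w) / 2" .
        moreover have "Im (g (Z (l t)) * (k *\<^sub>R (N * w))) = k * Im (2 * ?h * w) / 2"
          by (simp add: algebra_simps)
        moreover have "(1 - ?h)\<^sup>2 * w = (1 + ?h\<^sup>2) * w - 2 * ?h * w" by (simp add: power2_eq_square algebra_simps)
        ultimately show ?thesis by (simp only: minus_complex.sel) argo
      qed
      ultimately show ?thesis by (simp only:)
    qed
    obtain t where t: "0 \<le> t" "t \<le> r" and mt: "m r - m 0 = (r - 0) * (- Im ((1 - N * g (Z (l t)))\<^sup>2 * w) / 2)"
      using mvt_simple[OF r0, of m "\<lambda>t k. k * (- Im ((1 - N * g (Z (l t)))\<^sup>2 * w) / 2)"] dm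
      by (metis greaterThanLessThan_iff less_imp_le)
    have "- Im ((1 - N * g (Z (l t)))\<^sup>2 * w) = \<eta>\<^sup>2 - Im (((1 - N * g (Z (l t)))\<^sup>2 - \<kappa>\<^sup>2) * w)"
      unfolding left_diff_distrib \<kappa>w by simp
    moreover have "Im (((1 - N * g (Z (l t)))\<^sup>2 - \<kappa>\<^sup>2) * w) \<le> norm (((1 - N * g (Z (l t)))\<^sup>2 - \<kappa>\<^sup>2) * w)"
      using abs_Im_le_cmod abs_le_D1 by blast
    moreover have "norm (((1 - N * g (Z (l t)))\<^sup>2 - \<kappa>\<^sup>2) * w) \<le> \<eta>\<^sup>2 / 2"
      using osc[OF t] by (simp add: norm_mult nw)
    ultimately have "\<eta>\<^sup>2 / 4 \<le> - Im ((1 - N * g (Z (l t)))\<^sup>2 * w) / 2" by linarith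
    then have gain: "m r - m 0 \<ge> r * (\<eta>\<^sup>2 / 4)" unfolding mt using r0 by (simp add: mult_left_mono)
    define B where "B = Z (l r)"
    define u where "u = cnj N * (B - Q)"
    have BQ: "dist B Q \<le> r" using lip[of "l r" 0] lb[of r] lb[of 0] r0 nl[of r] by (simp add: B_def Z0 R)
    have nu: "norm u \<le> r" using BQ by (simp add: u_def norm_mult N dist_norm)
    have "l 0 = 0" by (simp add: l_def)
    then have \<psi>B: "\<psi> B - \<psi> Q \<ge> Im u + r * (\<eta>\<^sup>2 / 4)"
      using gain by (simp add: m_def B_def Z0 u_def algebra_simps)
    have AS: "A \<in> S"
    proof -
      have "A \<in> ball c R" using R by (simp add: A_def dist_norm norm_mult N)
      then show ?thesis using sub by blast
    qed
    have BS: "B \<in> S" using Zin[OF lb[of r]] Qsub sub r0 by (auto simp: B_def)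
    have "\<psi> B - \<psi> A \<le> norm (B - A)"
      using stream_function_lipschitz[OF \<psi> BS AS] by (simp add: dist_norm)
    also have "norm (B - A) = norm (of_real d * \<i> + u)"
    proof -
      have "cnj N * (B - A) = of_real d * \<i> * (cnj N * N) + u"
        by (simp add: u_def A_def Q_def d_def scaleR_conv_of_real algebra_simps)
      then have "norm (cnj N * (B - A)) = norm (of_real d * \<i> + u)" by (simp add: cnj_mult_self_unit[OF N])
      then show ?thesis by (simp add: norm_mult N)
    qed
    \<comment> \<open>In the rotated frame the displacement along the line is
      \<open>d + Im u\<close>, at least \<open>d / 2\<close>, and the transversal part is at most
      \<open>r\<close>; the latter therefore costs only second order,
      \<open>r^2 / (2 * (d + Im u))\<close>.\<close>
    also have "\<dots> \<le> d + Im u + r\<^sup>2 / d"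
    proof (rule power2_le_imp_le)
      have d0: "d > 0" using d R by simp
      have iu: "\<bar>Im u\<bar> \<le> r" using abs_Im_le_cmod[of u] nu by linarith
      have rd: "r \<le> d / 2" using rR d R by linarith
      have du: "d / 2 \<le> d + Im u" using iu rd by linarith
      have "(norm (of_real d * \<i> + u))\<^sup>2 = (d + Im u)\<^sup>2 + (Re u)\<^sup>2"
        unfolding cmod_power2 by simp
      also have "\<dots> \<le> (d + Im u)\<^sup>2 + r\<^sup>2"
        using abs_Re_le_cmod[of u] nu r0 by (metis abs_le_square_iff abs_of_pos add_left_mono order_trans)
      also have "r\<^sup>2 \<le> 2 * (d + Im u) * (r\<^sup>2 / d)"
        using mult_right_mono[OF du, of "2 * r\<^sup>2 / d"] d0 by (simp add: field_simps)
      also have "(d + Im u)\<^sup>2 + 2 * (d + Im u) * (r\<^sup>2 / d) \<le> (d + Im u + r\<^sup>2 / d)\<^sup>2"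
        unfolding power2_sum by simp
      finally show "(norm (of_real d * \<i> + u))\<^sup>2 \<le> (d + Im u + r\<^sup>2 / d)\<^sup>2" by simp
      show "0 \<le> d + Im u + r\<^sup>2 / d" using du d0 divide_nonneg_pos[OF zero_le_power2[of r] d0] by linarith
    qed
    finally have "r * (\<eta>\<^sup>2 / 4) \<le> r\<^sup>2 / d + 9/4 * (\<epsilon> * R)" using \<psi>B QA by linarith
    also have "r\<^sup>2 / d \<le> r\<^sup>2 / (R / 8)" using d R by (intro divide_left_mono) auto
    \<comment> \<open>Net gain \<open>r * \<eta>^2 * (1/4 - 1/10)\<close>, which is
      \<open>3/1600 * \<eta>^4 * R\<close>, against \<open>9/4 * \<epsilon> * R\<close>; both sides
      are multiplied by 1600.\<close>
    finally have "R * (3 * \<eta> ^ 4) \<le> R * (3600 * \<epsilon>)"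
      using R by (simp add: r_def power2_eq_square power4_eq_xxxx field_simps)
    then have "\<eta> ^ 4 \<le> 1200 * \<epsilon>" using R by simp
    then show ?thesis by (simp add: \<eta>_def \<kappa>_def \<epsilon>_def Q_def)
  next
    case True
    then show ?thesis by (simp add: \<eta>_def \<kappa>_def Q_def)
  qed
qed
end

section \<open>Symmetry of second partial derivatives\<close>

lemma has_derivative_partials:
  assumes "f differentiable (at z)"
  shows "(f has_derivative (\<lambda>h. px f z * fst h + py f z * snd h)) (at z)"
proof -
  obtain D where D: "(f has_derivative D) (at z)" using assms unfolding differentiable_def by blast
  interpret D: bounded_linear D using D by (rule has_derivative_bounded_linear)
  have D': "(f has_derivative D) (at (fst z, snd z))" using D by simp
  have "((\<lambda>s. f (s, snd z)) has_derivative (\<lambda>h. D (h, 0))) (at (fst z))"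
    by (rule has_derivative_compose[of "\<lambda>s. (s, snd z)", OF _ D']) (auto intro!: derivative_eq_intros)
  moreover have Dx: "(\<lambda>h. D (h, 0)) = (*) (D (1, 0))"
  proof
    show "D (h, 0) = D (1, 0) * h" for h using D.scaleR[of h "(1, 0)"] by (simp add: mult.commute)
  qed
  ultimately have x: "px f z = D (1, 0)"
    unfolding px_def by (intro DERIV_imp_deriv) (simp only: has_field_derivative_def)
  have "((\<lambda>s. f (fst z, s)) has_derivative (\<lambda>h. D (0, h))) (at (snd z))"
    by (rule has_derivative_compose[of "\<lambda>s. (fst z, s)", OF _ D']) (auto intro!: derivative_eq_intros)
  moreover have Dy: "(\<lambda>h. D (0, h)) = (*) (D (0, 1))"
  proof
    show "D (0, h) = D (0, 1) * h" for h using D.scaleR[of h "(0, 1)"] by (simp add: mult.commute)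
  qed
  ultimately have y: "py f z = D (0, 1)"
    unfolding py_def by (intro DERIV_imp_deriv) (simp only: has_field_derivative_def)
  have "D h = px f z * fst h + py f z * snd h" for h
    using D.add[of "(fst h, 0)" "(0, snd h)"] fun_cong[OF Dx, of "fst h"] fun_cong[OF Dy, of "snd h"] by (simp add: x y)
  then have "D = (\<lambda>h. px f z * fst h + py f z * snd h)" by blast
  with D show ?thesis by simp
qed

text \<open>The mean value theorem is used in the first variable only, and \<open>p\<close> is then
  linearized at the single point \<open>(a, b)\<close>. Differentiability of \<open>p\<close> there
  is enough, since the two errors add up to \<open>3/4 * e * h\<close>.\<close>

lemma second_difference_limit:
  fixes f p :: "real \<times> real \<Rightarrow> real"
  assumes V: "open V" "(a, b) \<in> V"
    and f: "\<And>w. w \<in> V \<Longrightarrow> ((\<lambda>x. f (x, snd w)) has_real_derivative p w) (at (fst w))"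
    and p: "(p has_derivative D) (at (a, b))"
  shows "((\<lambda>h. (f (a + h, b + h) - f (a + h, b) - f (a, b + h) + f (a, b)) / h\<^sup>2) \<longlongrightarrow> D (0, 1)) (at_right 0)"
proof (rule tendstoI)
  interpret D: bounded_linear D using p by (rule has_derivative_bounded_linear)
  fix e :: real assume e: "e > 0"
  obtain d1 where d1: "d1 > 0" "ball (a, b) d1 \<subseteq> V" using V openE by blast
  obtain d2 where d2: "d2 > 0"
    "\<And>w. norm (w - (a, b)) < d2 \<Longrightarrow> norm (p w - p (a, b) - D (w - (a, b))) \<le> e / 4 * norm (w - (a, b))"
    using p e unfolding has_derivative_at_alt by (meson divide_pos_pos zero_less_numeral)
  define d where "d = min d1 d2 / 2"
  have d: "d > 0" using d1 d2 by (simp add: d_def)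
  have near: "norm ((x, y) - (a, b)) \<le> \<bar>x - a\<bar> + \<bar>y - b\<bar>" for x y
    by (simp add: norm_Pair sqrt_sum_squares_le_sum_abs)
  have "dist ((f (a + h, b + h) - f (a + h, b) - f (a, b + h) + f (a, b)) / h\<^sup>2) (D (0, 1)) < e" if h: "0 < h" "h < d" for h
  proof -
    define m where "m x = f (x, b + h) - f (x, b)" for x
    have inV: "(x, b + k) \<in> V" if "a \<le> x" "x \<le> a + h" "0 \<le> k" "k \<le> h" for x k
    proof -
      have "norm ((x, b + k) - (a, b)) < d1" using near[of x "b + k"] that h by (simp add: d_def)
      then show ?thesis using d1(2) by (auto simp: dist_norm norm_minus_commute subset_iff)
    qed
    have "(m has_derivative (\<lambda>k. (p (x, b + h) - p (x, b)) * k)) (at x within {a..a+h})" if "a \<le> x" "x \<le> a + h" for x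
    proof -
      have "((\<lambda>x. f (x, b + h)) has_real_derivative p (x, b + h)) (at x)" using f[OF inV[OF that, of h]] h by simp
      moreover have "((\<lambda>x. f (x, b)) has_real_derivative p (x, b)) (at x)" using f[OF inV[OF that, of 0]] h by simp
      ultimately have "(m has_real_derivative p (x, b + h) - p (x, b)) (at x)"
        unfolding m_def by (rule DERIV_diff)
      then show ?thesis
        unfolding has_field_derivative_def by (rule has_derivative_at_withinI)
    qed
    from mvt_simple[of a "a + h" m "\<lambda>x k. (p (x, b + h) - p (x, b)) * k", OF _ this] h
    obtain x where x: "a < x" "x < a + h" "m (a + h) - m a = (p (x, b + h) - p (x, b)) * h" by auto
    have n1: "norm ((x, b + h) - (a, b)) \<le> 2 * h" using near[of x "b + h"] x h by simp
    have n2: "norm ((x, b) - (a, b)) \<le> h" using near[of x b] x by simp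
    have "\<bar>p (x, b + h) - p (a, b) - D ((x, b + h) - (a, b))\<bar> \<le> e / 4 * norm ((x, b + h) - (a, b))"
      using d2(2)[of "(x, b + h)"] n1 h by (simp add: d_def)
    also have "\<dots> \<le> e / 4 * (2 * h)" using n1 e by (intro mult_left_mono) auto
    finally have 1: "\<bar>p (x, b + h) - p (a, b) - D ((x, b + h) - (a, b))\<bar> \<le> e / 4 * (2 * h)" .
    have "\<bar>p (x, b) - p (a, b) - D ((x, b) - (a, b))\<bar> \<le> e / 4 * norm ((x, b) - (a, b))"
      using d2(2)[of "(x, b)"] n2 h by (simp add: d_def)
    also have "\<dots> \<le> e / 4 * h" using n2 e by (intro mult_left_mono) auto
    finally have 2: "\<bar>p (x, b) - p (a, b) - D ((x, b) - (a, b))\<bar> \<le> e / 4 * h" .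
    have "D ((x, b + h) - (a, b)) - D ((x, b) - (a, b)) = D (h *\<^sub>R (0, 1))"
      by (simp flip: D.diff)
    then have "D ((x, b + h) - (a, b)) - D ((x, b) - (a, b)) = h * D (0, 1)" by (simp only: D.scaleR) simp
    with 1 2 have 3: "\<bar>p (x, b + h) - p (x, b) - h * D (0, 1)\<bar> \<le> 3 / 4 * e * h" by linarith
    have "f (a + h, b + h) - f (a + h, b) - f (a, b + h) + f (a, b) = (p (x, b + h) - p (x, b)) * h"
      using x(3) by (simp add: m_def)
    then have "(f (a + h, b + h) - f (a + h, b) - f (a, b + h) + f (a, b)) / h\<^sup>2 - D (0, 1)
       = (p (x, b + h) - p (x, b) - h * D (0, 1)) / h"
      using h by (simp add: diff_divide_distrib power2_eq_square)
    then have "dist ((f (a + h, b + h) - f (a + h, b) - f (a, b + h) + f (a, b)) / h\<^sup>2) (D (0, 1)) \<le> 3 / 4 * e"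
      using 3 h by (simp add: dist_norm divide_le_eq)
    then show ?thesis using e by linarith
  qed
  then show "\<forall>\<^sub>F h in at_right 0. dist ((f (a + h, b + h) - f (a + h, b) - f (a, b + h) + f (a, b)) / h\<^sup>2) (D (0, 1)) < e"
    using d by (auto simp: eventually_at_right_field)
qed

lemma has_real_derivative_px:
  assumes "f differentiable (at z)"
  shows "((\<lambda>x. f (x, snd z)) has_real_derivative px f z) (at (fst z))"
proof -
  have "(f has_derivative (\<lambda>h. px f z * fst h + py f z * snd h)) (at (fst z, snd z))"
    using has_derivative_partials[OF assms] by simp
  then have "((\<lambda>s. f (s, snd z)) has_derivative (\<lambda>h. px f z * fst (h, 0::real) + py f z * snd (h, 0::real))) (at (fst z))"
    by (intro has_derivative_compose[of "\<lambda>s. (s, snd z)" _ _ _ f]) (auto intro!: derivative_eq_intros)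
  then show ?thesis by (simp add: has_field_derivative_def)
qed

lemma has_real_derivative_py:
  assumes "f differentiable (at z)"
  shows "((\<lambda>y. f (fst z, y)) has_real_derivative py f z) (at (snd z))"
proof -
  have "(f has_derivative (\<lambda>h. px f z * fst h + py f z * snd h)) (at (fst z, snd z))"
    using has_derivative_partials[OF assms] by simp
  then have "((\<lambda>s. f (fst z, s)) has_derivative (\<lambda>h. px f z * fst (0::real, h) + py f z * snd (0::real, h))) (at (snd z))"
    by (intro has_derivative_compose[of "\<lambda>s. (fst z, s)" _ _ _ f]) (auto intro!: derivative_eq_intros)
  then show ?thesis by (simp add: has_field_derivative_def)
qed

text \<open>The second difference is symmetric in the two variables, so applying its limit to
  \<open>f\<close> and to \<open>f\<close> with swapped arguments yields both mixed
  derivatives.\<close>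

lemma mixed_partials_eq:
  assumes V: "open V" "z \<in> V" and f: "\<And>w. w \<in> V \<Longrightarrow> f differentiable (at w)"
    and p: "px f differentiable (at z)" and q: "py f differentiable (at z)"
  shows "px (py f) z = py (px f) z"
proof -
  obtain a b where z: "z = (a, b)" by (cases z)
  let ?\<Delta> = "\<lambda>h. (f (a + h, b + h) - f (a + h, b) - f (a, b + h) + f (a, b)) / h\<^sup>2"
  have 1: "(?\<Delta> \<longlongrightarrow> py (px f) z) (at_right 0)"
    using second_difference_limit[OF V(1) V(2)[unfolded z] has_real_derivative_px[OF f] has_derivative_partials[OF p, unfolded z]]
    by (simp add: z)
  have "((\<lambda>h. (f (prod.swap (b + h, a + h)) - f (prod.swap (b + h, a)) - f (prod.swap (b, a + h)) + f (prod.swap (b, a))) / h\<^sup>2)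
      \<longlongrightarrow> px (py f) z * fst (prod.swap (0::real, 1::real)) + py (py f) z * snd (prod.swap (0::real, 1::real))) (at_right 0)"
  proof (rule second_difference_limit)
    show "open (prod.swap -` V)" by (rule open_vimage[OF V(1) continuous_on_swap])
    show "(b, a) \<in> prod.swap -` V" using V z by simp
    show "((\<lambda>x. f (prod.swap (x, snd w))) has_real_derivative py f (prod.swap w)) (at (fst w))"
      if "w \<in> prod.swap -` V" for w
      using has_real_derivative_py[OF f, of "prod.swap w"] that by auto
    have sw: "(prod.swap has_derivative prod.swap) (at (b, a))"
      by (simp add: bounded_linear_imp_has_derivative prod.swap_def[abs_def] bounded_linear_Pair bounded_linear_fst bounded_linear_snd)
    show "((\<lambda>w. py f (prod.swap w)) has_derivative (\<lambda>h. px (py f) z * fst (prod.swap h) + py (py f) z * snd (prod.swap h))) (at (b, a))"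
      by (rule has_derivative_compose[OF sw]) (use has_derivative_partials[OF q] z in simp)
  qed
  then have 2: "(?\<Delta> \<longlongrightarrow> px (py f) z) (at_right 0)" by (simp add: algebra_simps)
  show ?thesis by (rule tendsto_unique[OF _ 2 1]) simp
qed

section \<open>Transfer to charts\<close>

text \<open>This and \<open>plane_normal\<close> are the pointwise contents of
  \<open>mse_solution\<close> and \<open>gnormal\<close> for a function on the plane, so that charts
  can be treated separately.\<close>

definition mse_at :: "(real \<times> real \<Rightarrow> real) \<Rightarrow> real \<times> real \<Rightarrow> bool" where
  "mse_at f z \<longleftrightarrow> f differentiable (at z) \<and> px f differentiable (at z) \<and> py f differentiable (at z) \<and>
     (1 + (py f z)\<^sup>2) * px (px f) z - 2 * px f z * py f z * py (px f) z + (1 + (px f z)\<^sup>2) * py (py f) z = 0"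

definition plane_normal :: "(real \<times> real \<Rightarrow> real) \<Rightarrow> real \<times> real \<Rightarrow> real \<times> real \<times> real" where
  "plane_normal f z = (let W = sqrt (1 + (px f z)\<^sup>2 + (py f z)\<^sup>2) in (px f z / W, py f z / W, - 1 / W))"

text \<open>The complex conjugate of the stereographic projection of the normal from the north pole.\<close>
definition plane_gauss :: "(real \<times> real \<Rightarrow> real) \<Rightarrow> real \<times> real \<Rightarrow> complex" where
  "plane_gauss f z = Complex (px f z) (- py f z) / of_real (1 + sqrt (1 + (px f z)\<^sup>2 + (py f z)\<^sup>2))"

text \<open>Stereographic projection is a homeomorphism away from the north pole and takes the
  horizontal vector \<open>(n1, n2, 0)\<close> to the unit complex number
  \<open>Complex n1 n2\<close>; after conjugation, convergence means \<open>plane_gauss\<close>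
  tends to \<open>cnj ?N\<close>.\<close>

lemma plane_normal_tendsto_iff:
  assumes n: "n1\<^sup>2 + n2\<^sup>2 = 1"
  shows "(\<lambda>n. plane_normal (f n) z) \<longlonglongrightarrow> (n1, n2, 0) \<longleftrightarrow>
    (\<lambda>n. norm (1 - Complex n1 n2 * plane_gauss (f n) z)) \<longlonglongrightarrow> 0" (is "?L \<longleftrightarrow> ?R")
proof -
  let ?N = "Complex n1 n2"
  let ?G = "\<lambda>n. plane_gauss (f n) z"
  have NN: "cnj ?N * ?N = 1" using n by (simp add: complex_eq_iff power2_eq_square)
  define W where "W n = sqrt (1 + (px (f n) z)\<^sup>2 + (py (f n) z)\<^sup>2)" for n
  have W2: "(W n)\<^sup>2 = 1 + (px (f n) z)\<^sup>2 + (py (f n) z)\<^sup>2" for n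
    unfolding W_def by (simp add: add_nonneg_nonneg)
  have W1: "1 \<le> W n" for n unfolding W_def by simp
  have ne: "W n \<noteq> 0" "1 + W n \<noteq> 0" for n using W1[of n] by linarith+
  have normal: "plane_normal (f n) z = (px (f n) z / W n, py (f n) z / W n, - 1 / W n)" for n
    by (simp add: plane_normal_def W_def Let_def)
  have G: "Re (?G n) = px (f n) z / (1 + W n)" "Im (?G n) = - py (f n) z / (1 + W n)" for n
    by (simp_all add: plane_gauss_def W_def Re_divide_of_real Im_divide_of_real del: of_real_add)
  have "?L \<longleftrightarrow> ?G \<longlonglongrightarrow> cnj ?N"
  proof
    assume L: ?L
    have lim: "(\<lambda>n. px (f n) z / W n) \<longlonglongrightarrow> n1" "(\<lambda>n. py (f n) z / W n) \<longlonglongrightarrow> n2" "(\<lambda>n. - 1 / W n) \<longlonglongrightarrow> 0"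
      using tendsto_fst[OF L] tendsto_fst[OF tendsto_snd[OF L]] tendsto_snd[OF tendsto_snd[OF L]]
      by (simp_all add: normal)
    have Geq: "?G n = Complex ((px (f n) z / W n) / (1 - (- 1 / W n))) (- (py (f n) z / W n) / (1 - (- 1 / W n)))" for n
      using ne[of n] W1[of n] by (simp add: complex_eq_iff G field_simps)
    have "(\<lambda>n. Complex ((px (f n) z / W n) / (1 - (- 1 / W n))) (- (py (f n) z / W n) / (1 - (- 1 / W n))))
       \<longlonglongrightarrow> Complex (n1 / (1 - 0)) (- n2 / (1 - 0))"
      by (intro tendsto_intros lim) auto
    then show "?G \<longlonglongrightarrow> cnj ?N" unfolding Geq[symmetric] by (simp add: complex_cnj)
  next
    assume R: "?G \<longlonglongrightarrow> cnj ?N"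
    \<comment> \<open>Inverse stereographic projection: the vertical component of the normal
      recovered from the modulus of its image.\<close>
    define T where "T n = - (1 - (norm (?G n))\<^sup>2) / (1 + (norm (?G n))\<^sup>2)" for n
    have nG: "(norm (?G n))\<^sup>2 = (W n - 1) / (1 + W n)" for n
    proof -
      have "(norm (?G n))\<^sup>2 = ((px (f n) z)\<^sup>2 + (py (f n) z)\<^sup>2) / (1 + W n)\<^sup>2"
        unfolding cmod_power2 G by (simp add: power_divide add_divide_distrib)
      also have "(px (f n) z)\<^sup>2 + (py (f n) z)\<^sup>2 = (W n - 1) * (1 + W n)"
        using W2[of n] by (simp add: power2_eq_square algebra_simps)
      finally show ?thesis using ne[of n] by (simp add: power2_eq_square)
    qed
    have sq: "1 - (norm (?G n))\<^sup>2 = 2 / (1 + W n)" "1 + (norm (?G n))\<^sup>2 = 2 * W n / (1 + W n)" for n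
      unfolding nG using ne[of n] by (simp_all add: field_simps)
    have T: "T n = - 1 / W n" for n
      unfolding T_def sq using ne[of n] by (simp add: divide_simps)
    have T1: "1 - T n = (1 + W n) / W n" for n
      unfolding T using ne[of n] by (simp add: divide_simps)
    have eq: "plane_normal (f n) z = (Re (?G n) * (1 - T n), - Im (?G n) * (1 - T n), T n)" for n
      unfolding normal T1 G unfolding T using ne[of n] by simp
    have nN: "norm (cnj ?N) = 1" using n by (simp add: cmod_def)
    have Tlim: "T \<longlonglongrightarrow> - (1 - (norm (cnj ?N))\<^sup>2) / (1 + (norm (cnj ?N))\<^sup>2)"
      unfolding T_def by (intro tendsto_intros R) (simp add: nN del: complex_mod_cnj)
    then have "T \<longlonglongrightarrow> 0" by (simp add: nN del: complex_mod_cnj)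
    then have "(\<lambda>n. (Re (?G n) * (1 - T n), - Im (?G n) * (1 - T n), T n)) \<longlonglongrightarrow> (Re (cnj ?N) * (1 - 0), - Im (cnj ?N) * (1 - 0), 0)"
      by (intro tendsto_intros R)
    then show ?L by (simp add: eq)
  qed
  also have "\<dots> \<longleftrightarrow> ?R"
  proof
    assume "?G \<longlonglongrightarrow> cnj ?N"
    then have "(\<lambda>n. norm (1 - ?N * ?G n)) \<longlonglongrightarrow> norm (1 - ?N * cnj ?N)" by (intro tendsto_intros)
    then show ?R using NN by (simp add: mult.commute)
  next
    assume ?R
    then have "(\<lambda>n. 1 - ?N * ?G n) \<longlonglongrightarrow> 0" by (rule tendsto_norm_zero_cancel)
    then have "(\<lambda>n. cnj ?N * (1 - (1 - ?N * ?G n))) \<longlonglongrightarrow> cnj ?N * (1 - 0)" by (intro tendsto_intros)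
    moreover have "cnj ?N * (1 - (1 - ?N * ?G n)) = ?G n" for n
      using NN by (metis add_diff_cancel_left' diff_diff_eq2 mult.assoc mult_1 add.commute)
    ultimately show "?G \<longlonglongrightarrow> cnj ?N" by (simp only: diff_zero mult_1_right)
  qed
  finally show ?thesis .
qed

text \<open>The identification \<open>e\<close> of the complex numbers with pairs is a linear
  isometry; symmetry of the mixed partials supplies the shared \<open>s\<close>.\<close>

lemma minimal_gradient_of_mse_at:
  assumes mse: "\<And>z. z \<in> ball c R \<Longrightarrow> mse_at f z"
  defines "e \<equiv> \<lambda>w. (Re w, Im w)"
  shows "minimal_gradient (ball (Complex (fst c) (snd c)) R) (\<lambda>w. px f (e w)) (\<lambda>w. py f (e w))
     (\<lambda>w. px (px f) (e w)) (\<lambda>w. py (px f) (e w)) (\<lambda>w. py (py f) (e w))"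
proof
  have e: "(e has_derivative e) (at w)" for w
    unfolding e_def by (auto intro!: derivative_eq_intros)
  have eball: "e w \<in> ball c R" if "w \<in> ball (Complex (fst c) (snd c)) R" for w
  proof -
    have "dist c (e w) = dist (Complex (fst c) (snd c)) w"
      by (cases c) (simp add: e_def dist_norm norm_Pair cmod_def)
    then show ?thesis using that by simp
  qed
  fix w assume "w \<in> ball (Complex (fst c) (snd c)) R"
  then have w: "e w \<in> ball c R" by (rule eball)
  note m = mse[OF w, unfolded mse_at_def]
  show "((\<lambda>w. px f (e w)) has_derivative (\<lambda>v. px (px f) (e w) * Re v + py (px f) (e w) * Im v)) (at w)"
    using has_derivative_compose[OF e has_derivative_partials[of "px f" "e w"]] m by (simp add: e_def)
  have "px (py f) (e w) = py (px f) (e w)"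
    by (rule mixed_partials_eq[of "ball c R"]) (use w mse m in \<open>auto simp: mse_at_def\<close>)
  then show "((\<lambda>w. py f (e w)) has_derivative (\<lambda>v. py (px f) (e w) * Re v + py (py f) (e w) * Im v)) (at w)"
    using has_derivative_compose[OF e has_derivative_partials[of "py f" "e w"]] m by (simp add: e_def)
  show "(1 + (py f (e w))\<^sup>2) * px (px f) (e w) - 2 * px f (e w) * py f (e w) * py (px f) (e w) + (1 + (px f (e w))\<^sup>2) * py (py f) (e w) = 0"
    using m by blast
qed auto

section \<open>Propagation of normals in a plane disc\<close>

lemma plane_gauss_propagation:
  assumes R: "0 < R" and mse: "\<And>z. z \<in> ball c R \<Longrightarrow> mse_at f z"
    and n: "n1\<^sup>2 + n2\<^sup>2 = 1" and \<sigma>: "\<bar>\<sigma>\<bar> \<le> R / 8"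
  shows "norm (1 - Complex n1 n2 * plane_gauss f (c + \<sigma> *\<^sub>R (- n2, n1))) ^ 4
     \<le> 1200 * norm (1 - Complex n1 n2 * plane_gauss f c)"
proof -
  interpret minimal_gradient "ball (Complex (fst c) (snd c)) R" "\<lambda>w. px f (Re w, Im w)" "\<lambda>w. py f (Re w, Im w)"
     "\<lambda>w. px (px f) (Re w, Im w)" "\<lambda>w. py (px f) (Re w, Im w)" "\<lambda>w. py (py f) (Re w, Im w)"
    by (rule minimal_gradient_of_mse_at[OF mse])
  have g: "g w = plane_gauss f (Re w, Im w)" for w
    by (simp add: g_def W_def plane_gauss_def)
  have "norm (Complex n1 n2) = 1" using n by (simp add: cmod_def)
  from gauss_map_propagation[OF R subset_refl this \<sigma>]
  show ?thesis by (cases c) (simp add: g)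
qed

lemma plane_normal_propagation:
  assumes "0 < R" "\<And>n z. z \<in> ball c R \<Longrightarrow> mse_at (f n) z" "n1\<^sup>2 + n2\<^sup>2 = 1" "\<bar>\<sigma>\<bar> \<le> R / 8"
    and lim: "(\<lambda>n. plane_normal (f n) c) \<longlonglongrightarrow> (n1, n2, 0)"
  shows "(\<lambda>n. plane_normal (f n) (c + \<sigma> *\<^sub>R (- n2, n1))) \<longlonglongrightarrow> (n1, n2, 0)"
  unfolding plane_normal_tendsto_iff[OF assms(3)]
proof -
  let ?a = "\<lambda>n. norm (1 - Complex n1 n2 * plane_gauss (f n) (c + \<sigma> *\<^sub>R (- n2, n1)))"
  let ?b = "\<lambda>n. norm (1 - Complex n1 n2 * plane_gauss (f n) c)"
  have b: "(\<lambda>n. 1200 * ?b n) \<longlonglongrightarrow> 1200 * 0"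
    using lim unfolding plane_normal_tendsto_iff[OF assms(3)] by (intro tendsto_intros)
  have "(\<lambda>n. ?a n ^ 4) \<longlonglongrightarrow> 0"
  proof (rule tendsto_sandwich[of "\<lambda>_. 0"])
    show "\<forall>\<^sub>F n in sequentially. ?a n ^ 4 \<le> 1200 * ?b n"
      using plane_gauss_propagation[OF assms(1,2,3,4)] by simp
    show "(\<lambda>n. 1200 * ?b n) \<longlonglongrightarrow> 0" using b by simp
  qed auto
  \<comment> \<open>The estimate controls only the fourth power, so continuity of the fourth root
    finishes.\<close>
  then have "(\<lambda>n. root 4 (?a n ^ 4)) \<longlonglongrightarrow> root 4 0" by (rule tendsto_real_root)
  then show "?a \<longlonglongrightarrow> 0" by (simp add: real_root_power_cancel)
qed

section \<open>Locality of derivatives and independence of the chart\<close>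

lemma px_cong:
  assumes "open V" "z \<in> V" "\<And>w. w \<in> V \<Longrightarrow> f w = g w"
  shows "px f z = px g z"
  unfolding px_def
proof (rule deriv_cong_ev)
  have "open ((\<lambda>s. (s, snd z)) -` V)" by (intro open_vimage assms continuous_intros)
  then have "\<forall>\<^sub>F s in nhds (fst z). s \<in> (\<lambda>s. (s, snd z)) -` V"
    by (rule eventually_nhds_in_open) (use assms in simp)
  then show "\<forall>\<^sub>F s in nhds (fst z). f (s, snd z) = g (s, snd z)"
    by eventually_elim (use assms in simp)
qed simp

lemma py_cong:
  assumes "open V" "z \<in> V" "\<And>w. w \<in> V \<Longrightarrow> f w = g w"
  shows "py f z = py g z"
  unfolding py_def
proof (rule deriv_cong_ev)
  have "open ((\<lambda>s. (fst z, s)) -` V)" by (intro open_vimage assms continuous_intros)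
  then have "\<forall>\<^sub>F s in nhds (snd z). s \<in> (\<lambda>s. (fst z, s)) -` V"
    by (rule eventually_nhds_in_open) (use assms in simp)
  then show "\<forall>\<^sub>F s in nhds (snd z). f (fst z, s) = g (fst z, s)"
    by eventually_elim (use assms in simp)
qed simp

lemma differentiable_cong_open:
  assumes "open V" "z \<in> V" "\<And>w. w \<in> V \<Longrightarrow> f w = g w" "f differentiable (at z)"
  shows "g differentiable (at z)"
  using assms has_derivative_transform_within_open unfolding differentiable_def by metis

lemma mse_at_cong:
  assumes V: "open V" "z \<in> V" and eq: "\<And>w. w \<in> V \<Longrightarrow> f w = g w" and f: "mse_at f z"
  shows "mse_at g z"
proof -
  have x: "px f w = px g w" and y: "py f w = py g w" if "w \<in> V" for w
    using px_cong[OF V(1) that eq] py_cong[OF V(1) that eq] by auto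
  have "px (px f) z = px (px g) z" "py (px f) z = py (px g) z" "py (py f) z = py (py g) z"
    by (rule px_cong[OF V x] py_cong[OF V x] py_cong[OF V y]; assumption)+
  then show ?thesis
    using f x[OF V(2)] y[OF V(2)] differentiable_cong_open[OF V eq] differentiable_cong_open[OF V x]
      differentiable_cong_open[OF V y]
    unfolding mse_at_def by auto
qed

lemma plane_normal_cong:
  assumes "open V" "z \<in> V" "\<And>w. w \<in> V \<Longrightarrow> f w = g w"
  shows "plane_normal f z = plane_normal g z"
  unfolding plane_normal_def using px_cong[OF assms] py_cong[OF assms] by simp

text \<open>\<open>locinv\<close> is an arbitrary choice of a continuous local section through
  \<open>y\<close>, and a chart inverse shows that one exists. Near \<open>\<phi> y\<close> the
  section takes values in \<open>U\<close>, where \<open>\<phi>\<close> is injective, so it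
  coincides there with \<open>\<psi>\<close>.\<close>

lemma locinv_eq_chart_inverse:
  assumes U: "openin (top_of_set \<Omega>) U" "homeomorphism U (\<phi> ` U) \<phi> \<psi>" "open (\<phi> ` U)" and y: "y \<in> U"
  obtains V where "open V" "\<phi> y \<in> V" "\<And>z. z \<in> V \<Longrightarrow> locinv \<Omega> \<phi> y z = \<psi> z"
proof -
  have U\<Omega>: "U \<subseteq> \<Omega>" using U(1) by (rule openin_imp_subset)
  have inv: "\<psi> (\<phi> x) = x" if "x \<in> U" for x using U(2) that by (rule homeomorphism_apply1)
  have "\<exists>\<psi>. \<exists>V. open V \<and> \<phi> y \<in> V \<and> \<psi> (\<phi> y) = y \<and> continuous_on V \<psi> \<and> \<psi> ` V \<subseteq> \<Omega> \<and> (\<forall>z\<in>V. \<phi> (\<psi> z) = z)"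
    using U y U\<Omega> inv by (intro exI[of _ \<psi>] exI[of _ "\<phi> ` U"]) (auto simp: homeomorphism_def)
  from someI_ex[OF this, folded locinv_def]
  obtain V where V: "open V" "\<phi> y \<in> V" "locinv \<Omega> \<phi> y (\<phi> y) = y" "continuous_on V (locinv \<Omega> \<phi> y)"
    "locinv \<Omega> \<phi> y ` V \<subseteq> \<Omega>" "\<And>z. z \<in> V \<Longrightarrow> \<phi> (locinv \<Omega> \<phi> y z) = z" by blast
  obtain X where X: "open X" "U = \<Omega> \<inter> X" using U(1) by (auto simp: openin_open)
  show ?thesis
  proof (rule that)
    show "open (V \<inter> locinv \<Omega> \<phi> y -` X)" using V X by (intro continuous_open_preimage)
    show "\<phi> y \<in> V \<inter> locinv \<Omega> \<phi> y -` X" using V X y by auto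
    fix z assume z: "z \<in> V \<inter> locinv \<Omega> \<phi> y -` X"
    then have "locinv \<Omega> \<phi> y z \<in> U" using V(5) X by auto
    from inv[OF this] show "locinv \<Omega> \<phi> y z = \<psi> z" using V(6) z by auto
  qed
qed

text \<open>\<open>mse_solution\<close> uses a separate local inverse at each point. Their agreement
  with \<open>\<psi>\<close> near each image point makes \<open>u \<circ> \<psi>\<close> one
  function solving the equation on the whole chart image.\<close>

lemma mse_at_chart:
  assumes sol: "mse_solution \<Omega> \<phi> u"
    and U: "openin (top_of_set \<Omega>) U" "homeomorphism U (\<phi> ` U) \<phi> \<psi>" "open (\<phi> ` U)" and z: "z \<in> \<phi> ` U"
  shows "mse_at (u \<circ> \<psi>) z"
proof -
  obtain y where y: "y \<in> U" "z = \<phi> y" using z by blast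
  obtain V where V: "open V" "\<phi> y \<in> V" "\<And>z. z \<in> V \<Longrightarrow> locinv \<Omega> \<phi> y z = \<psi> z"
    using locinv_eq_chart_inverse[OF U y(1)] by blast
  have "interior_pt \<Omega> \<phi> y"
    unfolding interior_pt_def local_chart_def using U y openin_imp_subset by blast
  then have "mse_at (u \<circ> locinv \<Omega> \<phi> y) (\<phi> y)"
    using sol unfolding mse_solution_def mse_at_def Let_def by blast
  then show ?thesis
    unfolding y(2) by (rule mse_at_cong[OF V(1,2), rotated]) (simp add: V(3))
qed

lemma gnormal_chart:
  assumes U: "openin (top_of_set \<Omega>) U" "homeomorphism U (\<phi> ` U) \<phi> \<psi>" "open (\<phi> ` U)" and y: "y \<in> U"
  shows "gnormal \<Omega> \<phi> u y = plane_normal (u \<circ> \<psi>) (\<phi> y)"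
proof -
  obtain V where V: "open V" "\<phi> y \<in> V" "\<And>z. z \<in> V \<Longrightarrow> locinv \<Omega> \<phi> y z = \<psi> z"
    using locinv_eq_chart_inverse[OF U y] by blast
  have "gnormal \<Omega> \<phi> u y = plane_normal (u \<circ> locinv \<Omega> \<phi> y) (\<phi> y)"
    by (simp add: gnormal_def plane_normal_def Let_def)
  also have "\<dots> = plane_normal (u \<circ> \<psi>) (\<phi> y)"
    by (rule plane_normal_cong[OF V(1,2)]) (simp add: V(3))
  finally show ?thesis .
qed

section \<open>Propagation along the geodesic\<close>

theorem theorem3p3:
  fixes \<Omega> :: "'a::t2_space set" and \<phi> :: "'a \<Rightarrow> real \<times> real"
    and u :: "nat \<Rightarrow> 'a \<Rightarrow> real" and P :: 'a and n1 n2 :: real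
  assumes "multi_domain \<Omega> \<phi>"
    and "\<And>n. mse_solution \<Omega> \<phi> (u n)"
    and "interior_pt \<Omega> \<phi> P"
    and "n1\<^sup>2 + n2\<^sup>2 = 1"
    and "(\<lambda>n. gnormal \<Omega> \<phi> (u n) P) \<longlonglongrightarrow> (n1, n2, 0)"
  shows "\<forall>Q \<in> geodesic_through \<Omega> \<phi> P (- n2, n1).
           (\<lambda>n. gnormal \<Omega> \<phi> (u n) Q) \<longlonglongrightarrow> (n1, n2, 0)"
proof
  fix Q assume "Q \<in> geodesic_through \<Omega> \<phi> P (- n2, n1)"
  then obtain \<gamma> t I where Q: "Q = \<gamma> t" and I: "is_interval I" "open I" "0 \<in> I" "t \<in> I"
    and \<gamma>: "continuous_on I \<gamma>" "\<gamma> 0 = P"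
    and int: "\<And>s. s \<in> I \<Longrightarrow> interior_pt \<Omega> \<phi> (\<gamma> s)"
    and line: "\<And>s. s \<in> I \<Longrightarrow> \<phi> (\<gamma> s) = \<phi> P + s *\<^sub>R (- n2, n1)"
    unfolding geodesic_through_def by blast
  have unit: "norm (- n2, n1) = 1" using assms(4) by (simp add: norm_Pair add.commute)
  have "(\<lambda>n. gnormal \<Omega> \<phi> (u n) (\<gamma> t)) \<longlonglongrightarrow> (n1, n2, 0)"
  \<comment> \<open>The set of parameters with convergence is both open and closed in
    \<open>I\<close> once convergence passes between any two points of a small neighbourhood, in
    either direction.\<close>
  proof (rule connected_induction_simple[where S = I and a = 0 and
      P = "\<lambda>s. (\<lambda>n. gnormal \<Omega> \<phi> (u n) (\<gamma> s)) \<longlonglongrightarrow> (n1, n2, 0)"])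
    show "connected I" using I(1) by (rule is_interval_connected)
    show "(\<lambda>n. gnormal \<Omega> \<phi> (u n) (\<gamma> 0)) \<longlonglongrightarrow> (n1, n2, 0)" using assms(5) \<gamma>(2) by simp
    fix a assume a: "a \<in> I"
    then obtain U \<psi> where U: "openin (top_of_set \<Omega>) U" "homeomorphism U (\<phi> ` U) \<phi> \<psi>" "open (\<phi> ` U)" and aU: "\<gamma> a \<in> U"
      using int[OF a] unfolding interior_pt_def local_chart_def by blast
    obtain \<rho> where \<rho>: "\<rho> > 0" "ball (\<phi> (\<gamma> a)) \<rho> \<subseteq> \<phi> ` U" using U(3) aU by (meson imageI openE)
    obtain X where X: "open X" "U = \<Omega> \<inter> X" using U(1) by (auto simp: openin_open)
    \<comment> \<open>Two parameters in \<open>T\<close> differ by less than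
      \<open>\<rho> / 16\<close>, one eighth of the radius \<open>\<rho> / 2\<close> of a disc that
      fits into the chart around every \<open>\<phi> (\<gamma> x)\<close> with \<open>x\<close> in
      \<open>T\<close>.\<close>
    define T where "T = I \<inter> \<gamma> -` X \<inter> ball a (\<rho> / 32)"
    have "open T" unfolding T_def by (intro open_Int continuous_open_preimage \<gamma>(1) I(2) X(1)) auto
    then have "openin (top_of_set I) T" by (rule open_subset[rotated]) (auto simp: T_def)
    moreover have "a \<in> T" using a aU X \<rho> by (auto simp: T_def)
    moreover have "(\<lambda>n. gnormal \<Omega> \<phi> (u n) (\<gamma> y)) \<longlonglongrightarrow> (n1, n2, 0)"
      if x: "x \<in> T" and y: "y \<in> T" and lim: "(\<lambda>n. gnormal \<Omega> \<phi> (u n) (\<gamma> x)) \<longlonglongrightarrow> (n1, n2, 0)" for x y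
    proof -
      have I': "x \<in> I" "y \<in> I" and d: "dist a x < \<rho> / 32" "dist a y < \<rho> / 32" using x y by (auto simp: T_def)
      have "\<gamma> x \<in> \<Omega>" "\<gamma> y \<in> \<Omega>" using int I' by (auto simp: interior_pt_def)
      then have U': "\<gamma> x \<in> U" "\<gamma> y \<in> U" using x y X by (auto simp: T_def)
      have yx: "\<phi> (\<gamma> y) = \<phi> (\<gamma> x) + (y - x) *\<^sub>R (- n2, n1)"
        unfolding line[OF I'(1)] line[OF I'(2)] by (simp add: algebra_simps)
      have "\<phi> (\<gamma> a) - \<phi> (\<gamma> x) = (a - x) *\<^sub>R (- n2, n1)"
        unfolding line[OF I'(1)] line[OF a] by (simp add: algebra_simps)
      then have "dist (\<phi> (\<gamma> a)) (\<phi> (\<gamma> x)) = dist a x"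
        by (simp only: dist_norm norm_scaleR unit real_norm_def mult_1_right)
      then have "ball (\<phi> (\<gamma> x)) (\<rho> / 2) \<subseteq> ball (\<phi> (\<gamma> a)) \<rho>"
        using d(1) \<rho>(1) by (intro ball_subset_ball_iff[THEN iffD2]) (auto simp: dist_commute)
      then have mse: "mse_at (u n \<circ> \<psi>) z" if "z \<in> ball (\<phi> (\<gamma> x)) (\<rho> / 2)" for n z
        using that \<rho>(2) by (intro mse_at_chart[OF assms(2) U]) blast
      have \<sigma>: "\<bar>y - x\<bar> \<le> \<rho> / 2 / 8" using d unfolding dist_real_def by linarith
      have "(\<lambda>n. plane_normal (u n \<circ> \<psi>) (\<phi> (\<gamma> x))) \<longlonglongrightarrow> (n1, n2, 0)"
        using lim by (simp add: gnormal_chart[OF U U'(1)])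
      from plane_normal_propagation[OF _ mse assms(4) \<sigma> this]
      show ?thesis using \<rho>(1) by (simp add: gnormal_chart[OF U U'(2)] yx)
    qed
    ultimately show "\<exists>T. openin (top_of_set I) T \<and> a \<in> T \<and>
      (\<forall>x\<in>T. \<forall>y\<in>T. (\<lambda>n. gnormal \<Omega> \<phi> (u n) (\<gamma> x)) \<longlonglongrightarrow> (n1, n2, 0) \<longrightarrow> (\<lambda>n. gnormal \<Omega> \<phi> (u n) (\<gamma> y)) \<longlonglongrightarrow> (n1, n2, 0))"
      by blast
  qed (use I in auto)
  then show "(\<lambda>n. gnormal \<Omega> \<phi> (u n) Q) \<longlonglongrightarrow> (n1, n2, 0)" by (simp add: Q)
qed

end
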